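(* Let $A_n=\left(x_{L_n(i,j)}\mathbf 1_{\Delta_n}(i,j)\right)_{i,j=1}^{N}$, $n\ge 1$, be a sequence of $N\times N$ symmetric random matrices (with $N=N(n)$), and let $(p_n)$ be a sequence of even positive integers with $p_n=o(\log N/\log\log N)$. Suppose that (i) there is a constant $B<\infty$ such that $\sup_n\sup_{t\in\mathbb Z^d}\sup_{1\le k\le N(n)}\#\{l:1\le l\le N(n),\ L_n(k,l)=t\}\le B$; (ii) $\{x_i:i\in\mathbb Z^d\}$ are independent random variables with mean zero and there is a constant $\alpha>0$ such that $\sup_{i}\mathbb E|x_i|^k\le(\alpha k)^k$ for all $k\in\mathbb N$; (iii) there exists a constant $c>0$ such that $c^{p_n}N\le \operatorname{Var}\left(\operatorname{Tr}\left(\frac{A_n}{\sqrt N}\right)^{p_n}\right)$ for all $n$. Then $$\eta_{p_n}=\frac{\operatorname{Tr}\left(\frac{A_n}{\sqrt N}\right)^{p_n}-\mathbb E\operatorname{Tr}\left(\frac{A_n}{\sqrt N}\right)^{p_n}}{\sqrt{\operatorname{Var}\left(\operatorname{Tr}\left(\frac{A_n}{\sqrt N}\right)^{p_n}\right)}}$$ converges in distribution to the standard Gaussian distribution $N(0,1)$ as $n\to\infty$.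
   Context: Notation: $[N]=\{1,2,\ldots,N\}$. Fix $d\in\mathbb N$ and a strictly increasing function $N:\mathbb N\to\mathbb N$; write $N$ for $N(n)$. For each $n$, $L_n:[N(n)]^2\to\mathbb Z^d$ is a symmetric link function, i.e. $L_n(i,j)=L_n(j,i)$ for all $i,j$, and $\Delta_n\subseteq[N(n)]^2$ is a set such that $(i,j)\in\Delta_n$ implies $(j,i)\in\Delta_n$. The input sequence is a family $\{x_i:i\in\mathbb Z^d\}$ of real random variables. The $(i,j)$ entry of $A_n$ is $x_{L_n(i,j)}$ if $(i,j)\in\Delta_n$ and $0$ otherwise. *)

theory Defs
  imports "HOL-Probability.Probability" "HOL-Library.Landau_Symbols" "Jordan_Normal_Form.Matrix"
begin

text \<open>The lattice of link values is \<^typ>\<open>int ^ 'd\<close>.  Link functions and index sets use the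
  indices \<open>1, \<dots>, N\<close>, whereas matrices are indexed from \<open>0\<close>; hence the shift by \<^const>\<open>Suc\<close>.\<close>

definition patterned_matrix ::
    "nat \<Rightarrow> (nat \<Rightarrow> nat \<Rightarrow> int ^ 'd) \<Rightarrow> (nat \<times> nat) set \<Rightarrow> (int ^ 'd \<Rightarrow> real) \<Rightarrow> real mat" where
  "patterned_matrix N L \<Delta> x =
     Matrix.mat N N (\<lambda>(i, j). if (Suc i, Suc j) \<in> \<Delta> then x (L (Suc i) (Suc j)) else 0)"

definition mat_trace :: "'a::comm_monoid_add mat \<Rightarrow> 'a" where
  "mat_trace A = (\<Sum>i<dim_row A. A $$ (i, i))"

definition trace_power ::
    "nat \<Rightarrow> (nat \<Rightarrow> nat \<Rightarrow> int ^ 'd) \<Rightarrow> (nat \<times> nat) set \<Rightarrow> nat \<Rightarrow> (int ^ 'd \<Rightarrow> 'w \<Rightarrow> real) \<Rightarrow> 'w \<Rightarrow> real" where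
  "trace_power N L \<Delta> p x \<omega> =
     mat_trace (((1 / sqrt (real N)) \<cdot>\<^sub>m patterned_matrix N L \<Delta> (\<lambda>t. x t \<omega>)) ^\<^sub>m p)"

end

theory Submission
  imports Defs
begin

text \<open>
  The proof is by the method of moments. The trace of the power \<open>p\<close> is a sum over circuits of length \<open>p\<close> of
  monomials in the input variables, so that the \<open>k\<close>-th central moment is a sum over \<open>k\<close>-tuples of circuits of
  joint moments of centred monomials. Two circuits interact if they share a link value. By independence and
  since the variables have mean zero, a tuple contributes nothing if some link value occurs in it
  only once or if some circuit is isolated. If all circuits are matched up in pairs, the joint moment
  factorises. Call the remaining tuples entangled. Up to their contribution the moments obey the Gaussian
  recursion \<open>m\<^sub>k\<^sub>+\<^sub>2 = (k + 1) m\<^sub>2 m\<^sub>k\<close> (\<open>moment_recursion_error\<close>).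

  It remains to see that entangled tuples are rare (\<open>card_entangled_bound\<close>): there are at most
  \<open>N ^ ((k (p + 1) - 1) / 2)\<close> of them, up to factors that are subpolynomial in \<open>N\<close>, whereas the lower bound on the
  variance normalises by \<open>N ^ (k (p + 1) / 2)\<close>. To count tuples, choose the circuits one after the other. A circuit
  has one free base point and one free vertex per new link value, minus one if a new value occurs on a single
  edge, because this edge closes the circuit and its value is then forced. Each tuple is counted twice,
  in its given order and in reverse order. Adding the exponents of the two counts makes the estimate local:
  for each single circuit, the values shared with its predecessors and successors reduce the sum of its
  two exponents to at most \<open>p + 1\<close>, and to at most \<open>p\<close> if it shares values both with a predecessor and with a
  successor (\<open>fresh_cost_two_sided\<close>); the latter uses that \<open>p\<close> is even. An entangled tuple contains a circuit with
  two neighbours, which can be moved between them, and this gains the crucial factor \<open>sqrt N\<close>.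

  All other factors are powers \<open>(C p) ^ (C p)\<close>, which are \<open>N ^ o(1)\<close> by the growth condition on \<open>p\<close>. So the error in
  the recursion tends to zero, all moments converge to those of the Gaussian law, and the law is determined by
  its moments (\<open>weak_conv_std_normal_if_moments_tendsto\<close>).
\<close>

section \<open>Counting circuits\<close>

definition tuples :: "nat \<Rightarrow> 'a set \<Rightarrow> 'a list set" where
  "tuples k C = {cs. set cs \<subseteq> C \<and> length cs = k}"

lemma tuples_0 [simp]: "tuples 0 C = {[]}"
  by (auto simp: tuples_def)

lemma finite_tuples [simp]: "finite C \<Longrightarrow> finite (tuples k C)"
  by (simp add: tuples_def finite_lists_length_eq)

lemma sum_tuples_Suc: "(\<Sum>cs\<in>tuples (Suc k) C. f cs) = (\<Sum>c\<in>C. \<Sum>cs\<in>tuples k C. f (c # cs))"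
proof -
  have "(\<Sum>cs\<in>tuples (Suc k) C. f cs) = (\<Sum>(c, cs)\<in>C \<times> tuples k C. f (c # cs))"
    by (rule sum.reindex_bij_witness[of _ "\<lambda>(c, cs). c # cs" "\<lambda>cs. (hd cs, tl cs)"])
       (auto simp: tuples_def length_Suc_conv)
  then show ?thesis
    by (simp add: sum.cartesian_product)
qed

lemma sum_power_tuples:
  fixes f :: "'a \<Rightarrow> 'b::comm_semiring_1"
  shows "(\<Sum>c\<in>C. f c) ^ k = (\<Sum>cs\<in>tuples k C. \<Prod>c\<leftarrow>cs. f c)"
  by (induction k) (simp_all add: sum_tuples_Suc sum_product flip: sum_distrib_left)

text \<open>Circuits are lists of vertices read cyclically, so that a circuit of length \<open>p\<close> has \<open>p\<close> edges, and
  rotating the list changes the base point but not the multiset of link values.\<close>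

definition path_values :: "('a \<Rightarrow> 'a \<Rightarrow> 't) \<Rightarrow> 'a list \<Rightarrow> 't multiset" where
  "path_values L xs = image_mset (\<lambda>(u, v). L u v) (mset (zip xs (tl xs)))"

definition circuit_values :: "('a \<Rightarrow> 'a \<Rightarrow> 't) \<Rightarrow> 'a list \<Rightarrow> 't multiset" where
  "circuit_values L xs = image_mset (\<lambda>(u, v). L u v) (mset (zip xs (rotate1 xs)))"

lemma path_values_simps [simp]:
  "path_values L [v] = {#}"
  "path_values L (u # v # xs) = add_mset (L u v) (path_values L (v # xs))"
  by (simp_all add: path_values_def)

lemma size_circuit_values [simp]: "size (circuit_values L xs) = length xs"
  by (simp add: circuit_values_def)

lemma circuit_values_rotate:
  fixes xs :: "'a list"
  shows "circuit_values L (rotate k xs) = circuit_values L xs"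
proof -
  have *: "zip (rotate1 xs) (rotate1 ys) = rotate1 (zip xs ys)"
    if "length xs = length ys" for xs ys :: "'a list"
    using that by (cases xs; cases ys) auto
  have "zip (rotate k xs) (rotate1 (rotate k xs)) = rotate k (zip xs (rotate1 xs))"
  proof (induction k)
    case (Suc k)
    then show ?case using *[of "rotate k xs" "rotate1 (rotate k xs)"] by simp
  qed simp
  moreover have "mset (rotate k ys) = mset ys" for ys :: "('a \<times> 'a) list"
    by (metis append_take_drop_id mset_append rotate_drop_take union_commute)
  ultimately show ?thesis
    by (simp add: circuit_values_def)
qed

lemma circuit_values_closing_edge:
  assumes "xs \<noteq> []"
  shows "circuit_values L xs = add_mset (L (last xs) (hd xs)) (path_values L xs)"
proof -
  have "zip (v # xs) (xs @ [w]) = zip (v # xs) xs @ [(last (v # xs), w)]" for v w and xs :: "'a list"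
    by (induction xs arbitrary: v) auto
  with assms show ?thesis
    by (cases xs) (auto simp: circuit_values_def path_values_def)
qed

lemma edge_as_closing_edge:
  assumes "t \<in># circuit_values L xs"
  obtains e where "e < length xs" "L (last (rotate e xs)) (hd (rotate e xs)) = t"
proof -
  from assms obtain i where i: "i < length xs" "L (xs ! i) (rotate1 xs ! i) = t"
    by (auto simp: circuit_values_def in_set_zip)
  let ?n = "length xs"
  define e where "e = Suc i mod ?n"
  have ne: "xs \<noteq> []" "?n > 0" using i by auto
  have hd: "hd (rotate e xs) = rotate1 xs ! i"
    using i ne by (simp add: e_def hd_conv_nth nth_rotate nth_rotate1)
  have "last (rotate e xs) = xs ! ((e + (?n - 1)) mod ?n)"
    using ne by (simp add: last_conv_nth nth_rotate)
  also have "(e + (?n - 1)) mod ?n = (Suc i + (?n - 1)) mod ?n"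
    unfolding e_def by (simp add: mod_simps)
  also have "Suc i + (?n - 1) = i + ?n" using ne by simp
  also have "(i + ?n) mod ?n = i" using i by simp
  finally have "last (rotate e xs) = xs ! i" .
  with hd i ne show thesis
    by (intro that[of e]) (auto simp: e_def)
qed

text \<open>The number of free vertex choices, that is, the exponent of \<open>N\<close>, in counting circuits with link values
  \<open>V\<close> when the values in \<open>Z\<close> are already known. The base point is free, and each new value lets one
  vertex move freely, whereas an edge with a known value leaves at most \<open>B\<close> choices for its endpoint. If
  a new value occurs on a single edge, one choice is saved: start the walk at an end of
  this edge, so that the edge closes the walk and its value is determined by the vertices already chosen.\<close>

definition fresh_cost :: "'t set \<Rightarrow> 't multiset \<Rightarrow> nat" where
  "fresh_cost Z V = 1 + card (set_mset V - Z) - (if \<exists>t. t \<notin> Z \<and> count V t = 1 then 1 else 0)"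

text \<open>The weight \<open>1/N\<close> that is paid for a new value compensates the at most \<open>N\<close> choices for the next
  vertex; a value that has been seen costs nothing, but then only \<open>B\<close> vertices per known value are
  possible. Hence each step contributes a factor of at most \<open>1 + D\<close>.\<close>

lemma path_weight_bound:
  fixes L :: "'a \<Rightarrow> 'a \<Rightarrow> 't" and B D :: real
  assumes U: "finite U" "U \<noteq> {}"
    and L: "\<And>v t. v \<in> U \<Longrightarrow> real (card {u \<in> U. L v u = t}) \<le> B"
    and "v \<in> U" "finite Z" "B * real (card Z + m) \<le> D"
  shows "(\<Sum>xs\<in>tuples m U. (1 / real (card U)) ^ card (set_mset (path_values L (v # xs)) - Z)) \<le> (1 + D) ^ m"
  using assms(4-)
proof (induction m arbitrary: v Z)
  case 0
  then show ?case by simp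
next
  case (Suc m)
  let ?q = "1 / real (card U)"
  let ?S = "\<lambda>u Z. \<Sum>xs\<in>tuples m U. ?q ^ card (set_mset (path_values L (u # xs)) - Z)"
  have U0: "real (card U) > 0" using U by (simp add: card_gt_0_iff)
  have "card {u \<in> U. L v u = L v v} \<ge> 0" by simp
  then have B0: "B \<ge> 0" using L[OF Suc.prems(1), of "L v v"] by linarith
  have D0: "D \<ge> 0"
    using Suc.prems(3) B0 by (meson mult_nonneg_nonneg of_nat_0_le_iff order_trans)
  have IH: "?S u Z' \<le> (1 + D) ^ m" if "u \<in> U" "finite Z'" "card Z' \<le> card Z + 1" for u Z'
  proof (rule Suc.IH[OF that(1,2)])
    have "B * real (card Z' + m) \<le> B * real (card Z + Suc m)"
      using that(3) B0 by (intro mult_left_mono) auto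
    then show "B * real (card Z' + m) \<le> D" using Suc.prems(3) by linarith
  qed
  have step: "?q ^ card (set_mset (path_values L (v # u # xs)) - Z) =
      (if L v u \<in> Z then 1 else ?q) * ?q ^ card (set_mset (path_values L (u # xs)) - insert (L v u) Z)" for u xs
  proof (cases "L v u \<in> Z")
    case True
    then show ?thesis by (simp add: insert_Diff_if insert_absorb)
  next
    case False
    have "set_mset (path_values L (v # u # xs)) - Z =
        insert (L v u) (set_mset (path_values L (u # xs)) - insert (L v u) Z)"
      using False by auto
    then show ?thesis using False by simp
  qed
  have card_old: "real (card {u \<in> U. L v u \<in> Z}) \<le> D"
  proof -
    have "{u \<in> U. L v u \<in> Z} = (\<Union>t\<in>Z. {u \<in> U. L v u = t})" by auto
    then have "card {u \<in> U. L v u \<in> Z} \<le> (\<Sum>t\<in>Z. card {u \<in> U. L v u = t})"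
      using card_UN_le[OF Suc.prems(2), of "\<lambda>t. {u \<in> U. L v u = t}"] by simp
    then have "real (card {u \<in> U. L v u \<in> Z}) \<le> (\<Sum>t\<in>Z. real (card {u \<in> U. L v u = t}))"
      unfolding of_nat_sum[symmetric] of_nat_le_iff .
    also have "\<dots> \<le> (\<Sum>t\<in>Z. B)" using L Suc.prems(1) by (intro sum_mono) auto
    also have "\<dots> = B * real (card Z)" by simp
    also have "\<dots> \<le> B * real (card Z + Suc m)" using B0 by (intro mult_left_mono) auto
    finally show ?thesis using Suc.prems(3) by linarith
  qed
  have "(\<Sum>xs\<in>tuples (Suc m) U. ?q ^ card (set_mset (path_values L (v # xs)) - Z))
      = (\<Sum>u\<in>U. (if L v u \<in> Z then 1 else ?q) * ?S u (insert (L v u) Z))"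
    unfolding sum_tuples_Suc step sum_distrib_left ..
  also have "\<dots> \<le> (\<Sum>u\<in>U. (if L v u \<in> Z then 1 else ?q) * (1 + D) ^ m)"
    using Suc.prems by (intro sum_mono mult_left_mono IH) (auto simp: card_insert_if)
  also have "\<dots> = (\<Sum>u\<in>U. (if L v u \<in> Z then 1 else ?q)) * (1 + D) ^ m"
    by (simp add: sum_distrib_right)
  also have "\<dots> \<le> (\<Sum>u\<in>U. (if L v u \<in> Z then 1 else 0) + ?q) * (1 + D) ^ m"
    using D0 by (intro mult_right_mono sum_mono) auto
  also have "(\<Sum>u\<in>U. (if L v u \<in> Z then 1 else 0) + ?q) = real (card {u \<in> U. L v u \<in> Z}) + 1"
    using U U0 by (simp add: sum.distrib sum.If_cases Int_def)
  also have "\<dots> * (1 + D) ^ m \<le> (1 + D) * (1 + D) ^ m"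
    using card_old D0 by (intro mult_right_mono) auto
  finally show ?case by simp
qed

text \<open>Opening the circuit at a suitable edge reduces it to a path. Without a fresh single edge the opening
  is arbitrary, as dropping the closing edge can only lose new values. With such an edge, the circuit is
  rotated until that edge is the closing one; summing over the \<open>p\<close> rotations accounts for the unknown
  position and yields the factor \<open>p + 1\<close>.\<close>

lemma circuit_weight_bound:
  fixes L :: "'a \<Rightarrow> 'a \<Rightarrow> 't" and B D :: real
  assumes U: "finite U" "U \<noteq> {}"
    and L: "\<And>v t. v \<in> U \<Longrightarrow> real (card {u \<in> U. L v u = t}) \<le> B"
    and "finite Z" and D: "B * real (card Z + p) \<le> D" and p: "p > 0"
  shows "(\<Sum>xs\<in>tuples p U. (1 / real (card U)) ^ fresh_cost Z (circuit_values L xs))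
           \<le> real (p + 1) * (1 + D) ^ p"
proof -
  let ?q = "1 / real (card U)"
  define w where "w xs = ?q ^ (1 + card (set_mset (path_values L xs) - Z))" for xs
  obtain m where m: "p = Suc m" using p by (cases p) auto
  have U0: "real (card U) \<ge> 1" using U by (simp add: card_gt_0_iff Suc_leI)
  then have q: "0 \<le> ?q" "?q \<le> 1" by auto
  from U obtain v0 where v0: "v0 \<in> U" by auto
  have B0: "B \<ge> 0" using L[OF v0, of "L v0 v0"] by (meson of_nat_0_le_iff order_trans)
  have D0: "D \<ge> 0"
    using D B0 by (meson mult_nonneg_nonneg of_nat_0_le_iff order_trans)
  have w0: "w xs \<ge> 0" for xs unfolding w_def using q by simp
  have sum_w: "(\<Sum>xs\<in>tuples p U. w xs) \<le> (1 + D) ^ p"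
  proof -
    have "(\<Sum>xs\<in>tuples p U. w xs) =
        (\<Sum>v\<in>U. ?q * (\<Sum>xs\<in>tuples m U. ?q ^ card (set_mset (path_values L (v # xs)) - Z)))"
      unfolding m sum_tuples_Suc w_def by (simp add: sum_distrib_left)
    also have "\<dots> \<le> (\<Sum>v\<in>U. ?q * (1 + D) ^ m)"
    proof (intro sum_mono mult_left_mono path_weight_bound[OF U L])
      have "B * real (card Z + m) \<le> B * real (card Z + p)"
        unfolding m using B0 by (intro mult_left_mono) auto
      then show "B * real (card Z + m) \<le> D" using D by linarith
    qed (use assms q in auto)
    also have "\<dots> = (1 + D) ^ m" using U0 by simp
    also have "\<dots> \<le> (1 + D) ^ p" unfolding m using D0 by (intro power_increasing) auto
    finally show ?thesis .
  qed
  \<comment> \<open>The summand \<open>w xs\<close> serves circuits without, the rotations serve circuits with a fresh single edge.\<close>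
  have pointwise: "?q ^ fresh_cost Z (circuit_values L xs) \<le> w xs + (\<Sum>e<p. w (rotate e xs))"
    if xs: "xs \<in> tuples p U" for xs
  proof (cases "\<exists>t. t \<notin> Z \<and> count (circuit_values L xs) t = 1")
    case False
    have ne: "xs \<noteq> []" using xs p by (auto simp: tuples_def)
    have "card (set_mset (path_values L xs) - Z) \<le> card (set_mset (circuit_values L xs) - Z)"
      by (intro card_mono) (auto simp: circuit_values_closing_edge[OF ne])
    then have "?q ^ fresh_cost Z (circuit_values L xs) \<le> w xs"
      unfolding w_def fresh_cost_def using False q by (intro power_decreasing) auto
    moreover have "(\<Sum>e<p. w (rotate e xs)) \<ge> 0" using w0 by (intro sum_nonneg) auto
    ultimately show ?thesis by linarith
  next
    case True
    then obtain t where t: "t \<notin> Z" "count (circuit_values L xs) t = 1" by auto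
    then have "t \<in># circuit_values L xs" by (simp flip: count_greater_zero_iff)
    then obtain e where e: "e < length xs" "L (last (rotate e xs)) (hd (rotate e xs)) = t"
      by (rule edge_as_closing_edge)
    let ?ys = "rotate e xs"
    have ne: "?ys \<noteq> []" using e by auto
    have V: "circuit_values L xs = add_mset t (path_values L ?ys)"
      using circuit_values_closing_edge[OF ne, of L] e by (simp add: circuit_values_rotate)
    have tn: "t \<notin># path_values L ?ys"
      using t V by (simp add: not_in_iff)
    have "set_mset (circuit_values L xs) - Z = insert t (set_mset (path_values L ?ys) - Z)"
      using t V by auto
    then have "card (set_mset (circuit_values L xs) - Z) = Suc (card (set_mset (path_values L ?ys) - Z))"
      using tn by simp
    then have "?q ^ fresh_cost Z (circuit_values L xs) = w ?ys"
      unfolding w_def fresh_cost_def using True by auto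
    also have "\<dots> \<le> (\<Sum>e<p. w (rotate e xs))"
      using e xs w0 by (intro member_le_sum) (auto simp: tuples_def)
    finally show ?thesis using w0[of xs] by linarith
  qed
  have rot: "(\<Sum>xs\<in>tuples p U. w (rotate e xs)) = (\<Sum>xs\<in>tuples p U. w xs)" for e
  proof (rule sum.reindex_bij_betw)
    have inj: "inj_on (rotate e) (tuples p U)"
    proof (rule inj_onI)
      fix xs ys :: "'a list" assume *: "rotate e xs = rotate e ys"
      show "xs = ys" using * by (induction e) (auto dest: injD[OF inj_rotate1])
    qed
    moreover have "rotate e ` tuples p U \<subseteq> tuples p U" by (auto simp: tuples_def)
    ultimately show "bij_betw (rotate e) (tuples p U) (tuples p U)"
      using U(1) by (simp add: bij_betw_def endo_inj_surj)
  qed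
  have "(\<Sum>xs\<in>tuples p U. ?q ^ fresh_cost Z (circuit_values L xs))
      \<le> (\<Sum>xs\<in>tuples p U. w xs + (\<Sum>e<p. w (rotate e xs)))"
    by (intro sum_mono pointwise)
  also have "\<dots> = (\<Sum>xs\<in>tuples p U. w xs) + (\<Sum>e<p. \<Sum>xs\<in>tuples p U. w (rotate e xs))"
    by (simp add: sum.distrib) (rule sum.swap)
  also have "\<dots> = real (p + 1) * (\<Sum>xs\<in>tuples p U. w xs)"
    unfolding rot by (simp add: algebra_simps)
  also have "\<dots> \<le> real (p + 1) * (1 + D) ^ p"
    using sum_w by (intro mult_left_mono) auto
  finally show ?thesis .
qed

text \<open>The heart of the counting argument. Think of \<open>Z\<close> and \<open>Z'\<close> as the values seen in the circuits before and
  after the current one in a tuple of circuits. Writing \<open>n\<^sub>t\<close> for the multiplicity of \<open>t\<close> in \<open>V\<close>, the size of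
  \<open>V\<close> exceeds the two numbers of fresh values together by the sum of the nonnegative terms
  \<open>x t = n\<^sub>t - [t \<notin> Z] - [t \<notin> Z']\<close>. A value shared with an earlier circuit either has \<open>x t \<ge> 1\<close> or is a single
  edge that is fresh from the point of view of the later circuits, so that it saves a choice there;
  and symmetrically. This gives the first bound, and also the second if the two shared values can be
  chosen distinct. If the only candidate is one value on a single edge, evenness of the length
  provides a further value of odd multiplicity, which contributes as well.\<close>

lemma fresh_cost_two_sided:
  fixes Z Z' :: "'t set" and V :: "'t multiset"
  assumes double: "\<And>t. t \<in># V \<Longrightarrow> t \<notin> Z \<Longrightarrow> t \<notin> Z' \<Longrightarrow> count V t \<ge> 2"
  shows "set_mset V \<inter> (Z \<union> Z') \<noteq> {} \<Longrightarrow> fresh_cost Z V + fresh_cost Z' V \<le> size V + 1"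
    and "set_mset V \<inter> Z \<noteq> {} \<Longrightarrow> set_mset V \<inter> Z' \<noteq> {} \<Longrightarrow> even (size V) \<Longrightarrow>
           fresh_cost Z V + fresh_cost Z' V \<le> size V"
proof -
  define r where "r Z = (if \<exists>t. t \<notin> Z \<and> count V t = 1 then 1 else 0 :: int)" for Z :: "'t set"
  define x where "x t = int (count V t) - of_bool (t \<notin> Z) - of_bool (t \<notin> Z')" for t
  have r1: "r Z = 1" if "t \<notin> Z" "count V t = 1" for t Z
    using that by (auto simp: r_def)
  have r0: "0 \<le> r Z" for Z by (simp add: r_def)
  have cost: "int (fresh_cost Z V) = 1 + int (card (set_mset V - Z)) - r Z" for Z
    unfolding fresh_cost_def r_def by auto
  have card: "int (card (set_mset V - Z)) = (\<Sum>t\<in>set_mset V. of_bool (t \<notin> Z))" for Z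
    by (simp add: of_bool_def sum.If_cases set_diff_eq Int_def)
  have x_sum: "int (size V) - int (card (set_mset V - Z)) - int (card (set_mset V - Z')) = (\<Sum>t\<in>set_mset V. x t)"
    unfolding x_def card sum_subtractf by (simp add: size_multiset_overloaded_eq)
  have x0: "x t \<ge> 0" if "t \<in># V" for t
    using double[OF that] that unfolding x_def
    by (cases "t \<in> Z"; cases "t \<in> Z'") (auto simp: Suc_leI simp flip: count_greater_zero_iff)
  \<comment> \<open>Each value shared with the earlier circuits gains one unit, in the term itself or in the saving.\<close>
  have left: "x t + r Z' \<ge> 1 \<and> (x t \<ge> 1 \<or> r Z' = 1)" if "t \<in># V" "t \<in> Z" for t
  proof -
    have c: "count V t \<ge> 1" using that by (simp add: Suc_leI)
    show ?thesis
    proof (cases "t \<notin> Z' \<and> count V t = 1")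
      case True
      then have "r Z' = 1" using r1 by auto
      then show ?thesis using x0[OF that(1)] by auto
    next
      case False
      with c have "t \<notin> Z' \<longrightarrow> count V t \<ge> 2" by linarith
      then have "x t \<ge> 1" using c that unfolding x_def by auto
      then show ?thesis using r0[of Z'] by auto
    qed
  qed
  have right: "x t + r Z \<ge> 1 \<and> (x t \<ge> 1 \<or> r Z = 1)" if "t \<in># V" "t \<in> Z'" for t
  proof -
    have c: "count V t \<ge> 1" using that by (simp add: Suc_leI)
    show ?thesis
    proof (cases "t \<notin> Z \<and> count V t = 1")
      case True
      then have "r Z = 1" using r1 by auto
      then show ?thesis using x0[OF that(1)] by auto
    next
      case False
      with c have "t \<notin> Z \<longrightarrow> count V t \<ge> 2" by linarith
      then have "x t \<ge> 1" using c that unfolding x_def by auto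
      then show ?thesis using r0[of Z] by auto
    qed
  qed
  have one: "x t \<le> (\<Sum>t\<in>set_mset V. x t)" if "t \<in># V" for t
    using that x0 by (intro member_le_sum) auto
  have two: "x t + x u \<le> (\<Sum>t\<in>set_mset V. x t)" if "t \<in># V" "u \<in># V" "t \<noteq> u" for t u
  proof -
    have "(\<Sum>s\<in>{t, u}. x s) \<le> (\<Sum>s\<in>set_mset V. x s)"
      using that x0 by (intro sum_mono2) auto
    then show ?thesis using that by simp
  qed
  show "fresh_cost Z V + fresh_cost Z' V \<le> size V + 1" if meet: "set_mset V \<inter> (Z \<union> Z') \<noteq> {}"
  proof -
    from meet obtain t where "t \<in># V" "t \<in> Z \<or> t \<in> Z'" by auto
    then have "(\<Sum>t\<in>set_mset V. x t) + r Z + r Z' \<ge> 1"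
      using left[of t] right[of t] one[of t] r0[of Z] r0[of Z'] by auto
    then show ?thesis using cost[of Z] cost[of Z'] x_sum by linarith
  qed
  show "fresh_cost Z V + fresh_cost Z' V \<le> size V"
    if meet: "set_mset V \<inter> Z \<noteq> {}" "set_mset V \<inter> Z' \<noteq> {}" and ev: "even (size V)"
  proof -
    from meet obtain u w where uw: "u \<in># V" "u \<in> Z" "w \<in># V" "w \<in> Z'" by auto
    have "(\<Sum>t\<in>set_mset V. x t) + r Z + r Z' \<ge> 2"
    proof (cases "u = w")
      case False
      then show ?thesis using left[of u] right[of w] two[of u w] uw by auto
    next
      case True
      then have xu: "x u = int (count V u)" using uw by (simp add: x_def)
      have cu: "count V u \<ge> 1" using uw by (simp add: Suc_leI)
      show ?thesis
      proof (cases "count V u = 1")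
        case False
        then have "count V u \<ge> 2" using cu by linarith
        then show ?thesis using one[of u] xu uw r0[of Z] r0[of Z'] by auto
      next
        case True
        have "\<exists>t\<in>set_mset V - {u}. odd (count V t)"
        proof (rule ccontr)
          assume "\<not> ?thesis"
          then have "even (\<Sum>t\<in>set_mset V - {u}. count V t)" by (intro dvd_sum) auto
          moreover have "size V = count V u + (\<Sum>t\<in>set_mset V - {u}. count V t)"
            using uw by (simp add: size_multiset_overloaded_eq sum.remove)
          ultimately show False using ev True by simp
        qed
        then obtain t where t: "t \<in># V" "t \<noteq> u" "odd (count V t)" by auto
        have "x t + r Z + r Z' \<ge> 1"
        proof (cases "t \<in> Z \<or> t \<in> Z'")
          case True
          then show ?thesis using left[of t] right[of t] t r0[of Z] r0[of Z'] by auto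
        next
          case False
          then have "count V t \<ge> 2" using double t by auto
          then have "count V t \<ge> 3" using t(3) by (cases "count V t = 2") auto
          then show ?thesis using False r0[of Z] r0[of Z'] by (simp add: x_def)
        qed
        then show ?thesis using two[of u t] t uw xu True by auto
      qed
    qed
    then show ?thesis using cost[of Z] cost[of Z'] x_sum by linarith
  qed
qed

section \<open>Counting tuples of circuits\<close>

text \<open>The cost of choosing the circuits of a tuple one after the other, each one knowing the values of its
  predecessors. Reversing the tuple gives a second way to count the same tuple, and neither of the two is
  good enough alone.\<close>

fun tuple_cost :: "'t set \<Rightarrow> 't multiset list \<Rightarrow> nat" where
  "tuple_cost Z [] = 0"
| "tuple_cost Z (V # Vs) = fresh_cost Z V + tuple_cost (Z \<union> set_mset V) Vs"

lemma tuple_cost_weight_bound: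
  fixes V :: "'c \<Rightarrow> 't multiset" and q :: real
  assumes "finite C" and q: "0 \<le> q"
    and V: "\<And>c. c \<in> C \<Longrightarrow> size (V c) = p"
    and one: "\<And>Z. finite Z \<Longrightarrow> card Z \<le> z \<Longrightarrow> (\<Sum>c\<in>C. q ^ fresh_cost Z (V c)) \<le> K"
    and "finite Z" "card Z + k * p \<le> z"
  shows "(\<Sum>cs\<in>tuples k C. q ^ tuple_cost Z (map V cs)) \<le> K ^ k"
  using assms(5-)
proof (induction k arbitrary: Z)
  case 0
  then show ?case by simp
next
  case (Suc k)
  have "(\<Sum>c\<in>C. q ^ fresh_cost Z (V c)) \<ge> 0" using q by (intro sum_nonneg) auto
  then have K0: "0 \<le> K" using one[of Z] Suc.prems by simp
  have "(\<Sum>cs\<in>tuples (Suc k) C. q ^ tuple_cost Z (map V cs)) =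
      (\<Sum>c\<in>C. q ^ fresh_cost Z (V c) * (\<Sum>cs\<in>tuples k C. q ^ tuple_cost (Z \<union> set_mset (V c)) (map V cs)))"
    by (simp add: sum_tuples_Suc power_add sum_distrib_left)
  also have "\<dots> \<le> (\<Sum>c\<in>C. q ^ fresh_cost Z (V c) * K ^ k)"
  proof (intro sum_mono mult_left_mono Suc.IH)
    fix c assume c: "c \<in> C"
    have "card (Z \<union> set_mset (V c)) \<le> card Z + card (set_mset (V c))" by (rule card_Un_le)
    also have "card (set_mset (V c)) \<le> size (V c)"
      by (metis card_eq_sum count_greater_eq_one_iff size_multiset_overloaded_eq sum_mono)
    finally show "card (Z \<union> set_mset (V c)) + k * p \<le> z" using Suc.prems(2) V[OF c] by simp
  qed (use q Suc.prems in auto)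
  also have "\<dots> = (\<Sum>c\<in>C. q ^ fresh_cost Z (V c)) * K ^ k" by (simp add: sum_distrib_right)
  also have "\<dots> \<le> K * K ^ k" using one[of Z] Suc.prems K0 by (intro mult_right_mono) auto
  finally show ?case by simp
qed

lemma tuple_cost_eq_sum:
  "tuple_cost Z Vs = (\<Sum>i<length Vs. fresh_cost (Z \<union> (\<Union>V\<in>set (take i Vs). set_mset V)) (Vs ! i))"
proof (induction Vs arbitrary: Z)
  case (Cons V Vs)
  show ?case
    by (simp add: Cons.IH sum.lessThan_Suc_shift Un_assoc del: sum.lessThan_Suc)
qed simp

lemma tuple_cost_rev_eq_sum:
  "tuple_cost {} (rev Vs) = (\<Sum>i<length Vs. fresh_cost (\<Union>V\<in>set (drop (Suc i) Vs). set_mset V) (Vs ! i))"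
proof -
  have "tuple_cost {} (rev Vs) =
      (\<Sum>i<length Vs. fresh_cost (\<Union>V\<in>set (take i (rev Vs)). set_mset V) (rev Vs ! i))"
    by (simp add: tuple_cost_eq_sum)
  also have "\<dots> = (\<Sum>i<length Vs. fresh_cost (\<Union>V\<in>set (take (length Vs - Suc i) (rev Vs)). set_mset V)
      (rev Vs ! (length Vs - Suc i)))"
    by (rule sum.nat_diff_reindex[symmetric])
  also have "\<dots> = (\<Sum>i<length Vs. fresh_cost (\<Union>V\<in>set (drop (Suc i) Vs). set_mset V) (Vs ! i))"
    by (intro sum.cong) (auto simp: take_rev rev_nth)
  finally show ?thesis .
qed

definition overlap :: "'t multiset list \<Rightarrow> nat \<Rightarrow> nat \<Rightarrow> bool" where
  "overlap Vs i j \<longleftrightarrow> i \<noteq> j \<and> i < length Vs \<and> j < length Vs \<and> set_mset (Vs ! i) \<inter> set_mset (Vs ! j) \<noteq> {}"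

text \<open>The tuples that obstruct Wick's formula: no link value occurs exactly once in total, no circuit is
  isolated, but the circuits are not just matched up in pairs either.\<close>

definition entangled :: "'t multiset list \<Rightarrow> bool" where
  "entangled Vs \<longleftrightarrow>
     (\<forall>t. count (sum_list Vs) t \<noteq> 1) \<and>
     (\<forall>i<length Vs. \<exists>j. overlap Vs i j) \<and>
     (\<exists>i j j'. j \<noteq> j' \<and> overlap Vs i j \<and> overlap Vs i j')"

lemma overlap_sym: "overlap Vs i j \<longleftrightarrow> overlap Vs j i"
  by (auto simp: overlap_def)

text \<open>Summing the two-sided estimate over all positions: a tuple of \<open>k\<close> circuits of length \<open>p\<close> without
  isolated members and unmatched values has total two-sided cost at most \<open>k (p + 1)\<close>, which is the exponent that a perfect
  pairing attains. A circuit that sits between two circuits it overlaps with gains one extra unit.\<close>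

lemma tuple_cost_two_sided:
  fixes Vs :: "'t multiset list"
  assumes single: "\<And>t. count (sum_list Vs) t \<noteq> 1"
    and meets: "\<And>i. i < length Vs \<Longrightarrow> \<exists>j. overlap Vs i j"
    and mid: "overlap Vs i j" "overlap Vs i j'" "j < i" "i < j'"
    and p: "\<And>V. V \<in> set Vs \<Longrightarrow> size V = p" "even p"
  shows "tuple_cost {} Vs + tuple_cost {} (rev Vs) + 1 \<le> length Vs * (p + 1)"
proof -
  define Z where "Z i = (\<Union>V\<in>set (take i Vs). set_mset V)" for i
  define Z' where "Z' i = (\<Union>V\<in>set (drop (Suc i) Vs). set_mset V)" for i
  have in_Z: "set_mset (Vs ! j) \<subseteq> Z i" if "j < i" "i < length Vs" for i j
    using that by (auto simp: Z_def in_set_conv_nth intro!: bexI[of _ "Vs ! j"] exI[of _ j])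
  have in_Z': "set_mset (Vs ! j) \<subseteq> Z' i" if "i < j" "j < length Vs" for i j
    using that by (auto simp: Z'_def in_set_conv_nth intro!: bexI[of _ "Vs ! j"] exI[of _ "j - Suc i"] diff_less_mono)
  \<comment> \<open>A value that occurs neither before nor after \<open>i\<close> has all its occurrences in circuit \<open>i\<close>.\<close>
  have double: "count (Vs ! i) t \<ge> 2"
    if i: "i < length Vs" and t: "t \<in># Vs ! i" "t \<notin> Z i" "t \<notin> Z' i" for i t
  proof -
    have "Vs = take i Vs @ Vs ! i # drop (Suc i) Vs" using i by (rule id_take_nth_drop)
    then have "sum_list Vs = sum_list (take i Vs) + Vs ! i + sum_list (drop (Suc i) Vs)"
      by (metis sum_list.Cons sum_list_append add.assoc)
    moreover have "count (sum_list (take i Vs)) t = 0" "count (sum_list (drop (Suc i) Vs)) t = 0"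
    proof -
      have "count (sum_list Ws) t = 0" if "\<And>W. W \<in> set Ws \<Longrightarrow> t \<notin># W" for Ws
        using that by (induction Ws) (auto simp: not_in_iff)
      then show "count (sum_list (take i Vs)) t = 0" "count (sum_list (drop (Suc i) Vs)) t = 0"
        using t unfolding Z_def Z'_def by blast+
    qed
    ultimately have "count (sum_list Vs) t = count (Vs ! i) t" by simp
    moreover have "count (Vs ! i) t \<ge> 1" using t by (simp add: Suc_leI)
    ultimately show ?thesis using single[of t] by linarith
  qed
  have each: "fresh_cost (Z i) (Vs ! i) + fresh_cost (Z' i) (Vs ! i) \<le> p + 1" if i: "i < length Vs" for i
  proof -
    obtain j where "overlap Vs i j" using meets i by auto
    then have "set_mset (Vs ! i) \<inter> (Z i \<union> Z' i) \<noteq> {}"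
      using in_Z[of j i] in_Z'[of i j] by (cases "j < i") (auto simp: overlap_def not_less)
    then show ?thesis
      using fresh_cost_two_sided(1)[of "Vs ! i" "Z i" "Z' i"] double[OF i] p(1)[of "Vs ! i"] i by simp
  qed
  have i: "i < length Vs" using mid(1) by (simp add: overlap_def)
  have "fresh_cost (Z i) (Vs ! i) + fresh_cost (Z' i) (Vs ! i) \<le> size (Vs ! i)"
  proof (rule fresh_cost_two_sided(2))
    show "set_mset (Vs ! i) \<inter> Z i \<noteq> {}" "set_mset (Vs ! i) \<inter> Z' i \<noteq> {}"
      using mid in_Z[of j i] in_Z'[of i j'] by (auto simp: overlap_def)
  qed (use double[OF i] p i in auto)
  then have special: "fresh_cost (Z i) (Vs ! i) + fresh_cost (Z' i) (Vs ! i) \<le> p"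
    using p(1) i by simp
  have "tuple_cost {} Vs + tuple_cost {} (rev Vs) =
      (\<Sum>i<length Vs. fresh_cost (Z i) (Vs ! i) + fresh_cost (Z' i) (Vs ! i))"
    unfolding tuple_cost_rev_eq_sum by (simp add: tuple_cost_eq_sum Z_def Z'_def sum.distrib)
  also have "\<dots> = (fresh_cost (Z i) (Vs ! i) + fresh_cost (Z' i) (Vs ! i)) +
      (\<Sum>i\<in>{..<length Vs} - {i}. fresh_cost (Z i) (Vs ! i) + fresh_cost (Z' i) (Vs ! i))"
    using i by (subst sum.remove[of _ i]) auto
  also have "\<dots> \<le> p + (\<Sum>i\<in>{..<length Vs} - {i}. p + 1)"
    by (rule add_mono[OF special], rule sum_mono) (use each in auto)
  also have "\<dots> + 1 = length Vs * (p + 1)"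
    using i by (cases "length Vs") (auto simp: card_Diff_singleton)
  finally show ?thesis by simp
qed

text \<open>Exchanging two entries of a tuple serves to move a circuit with two neighbours between them.\<close>

definition swap_entries :: "nat \<times> nat \<Rightarrow> 'a list \<Rightarrow> 'a list" where
  "swap_entries ab xs = map (\<lambda>i. xs ! Transposition.transpose (fst ab) (snd ab) i) [0..<length xs]"

lemma length_swap_entries [simp]: "length (swap_entries ab xs) = length xs"
  by (simp add: swap_entries_def)

lemma transpose_less: "a < n \<Longrightarrow> b < n \<Longrightarrow> i < n \<Longrightarrow> Transposition.transpose a b i < (n::nat)"
  by (auto simp: Transposition.transpose_def)

lemma nth_swap_entries:
  "i < length xs \<Longrightarrow> swap_entries (a, b) xs ! i = xs ! Transposition.transpose a b i"
  by (simp add: swap_entries_def)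

lemma swap_entries_swap_entries:
  "a < length xs \<Longrightarrow> b < length xs \<Longrightarrow> swap_entries (a, b) (swap_entries (a, b) xs) = xs"
  by (rule nth_equalityI) (auto simp: nth_swap_entries transpose_less)

lemma mset_swap_entries:
  assumes "a < length xs" "b < length xs"
  shows "mset (swap_entries (a, b) xs) = mset xs"
proof -
  have "swap_entries (a, b) xs = xs[a := xs ! b, b := xs ! a]"
    using assms by (intro nth_equalityI) (auto simp: nth_swap_entries nth_list_update Transposition.transpose_def)
  then show ?thesis using mset_swap[OF assms(2,1)] by simp
qed

lemma swap_entries_map:
  "a < length xs \<Longrightarrow> b < length xs \<Longrightarrow> map f (swap_entries (a, b) xs) = swap_entries (a, b) (map f xs)"
  by (rule nth_equalityI) (auto simp: nth_swap_entries transpose_less)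

lemma overlap_swap_entries:
  assumes "a < length Vs" "b < length Vs"
  shows "overlap (swap_entries (a, b) Vs) (Transposition.transpose a b i) (Transposition.transpose a b j)
           \<longleftrightarrow> overlap Vs i j"
proof -
  have *: "Transposition.transpose a b i < length Vs \<longleftrightarrow> i < length Vs" for i
    using assms by (auto simp: Transposition.transpose_def)
  have inj: "Transposition.transpose a b i = Transposition.transpose a b j \<longleftrightarrow> i = j"
    by (metis transpose_involutory)
  show ?thesis
  proof (cases "i < length Vs \<and> j < length Vs")
    case True
    then show ?thesis using assms by (simp add: overlap_def nth_swap_entries * inj)
  next
    case False
    then show ?thesis by (simp add: overlap_def *) blast
  qed
qed

text \<open>Of the three positions of a circuit and its two neighbours, exchange the circuit with the middle one.\<close>

lemma entangled_tuple_cost: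
  assumes ent: "entangled Vs" and p: "\<And>V. V \<in> set Vs \<Longrightarrow> size V = p" "even p"
  obtains a b where "a < length Vs" "b < length Vs"
    "tuple_cost {} (swap_entries (a, b) Vs) + tuple_cost {} (rev (swap_entries (a, b) Vs)) + 1
       \<le> length Vs * (p + 1)"
proof -
  from ent obtain i j j' where ijj: "j < j'" "overlap Vs i j" "overlap Vs i j'"
    unfolding entangled_def by (metis linorder_neqE_nat)
  have lt: "i < length Vs" "j < length Vs" "j' < length Vs" "i \<noteq> j" "i \<noteq> j'"
    using ijj by (auto simp: overlap_def)
  obtain m where m: "m < length Vs"
    "\<exists>h h'. h < m \<and> m < h' \<and> {h, h'} = Transposition.transpose i m ` {j, j'}"
  proof -
    consider "i < j" | "j < i" "i < j'" | "j' < i" using lt by linarith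
    then show thesis
    proof cases
      case 1
      then show thesis using ijj lt by (intro that[of j]) (auto simp: Transposition.transpose_def)
    next
      case 2
      then show thesis using ijj lt by (intro that[of i]) auto
    next
      case 3
      then show thesis using ijj lt by (intro that[of j']) (auto simp: Transposition.transpose_def)
    qed
  qed
  let ?Ws = "swap_entries (i, m) Vs"
  from m obtain h h' where h: "h < m" "m < h'" "{h, h'} = Transposition.transpose i m ` {j, j'}" by auto
  have ov: "overlap ?Ws m (Transposition.transpose i m j)" "overlap ?Ws m (Transposition.transpose i m j')"
    using overlap_swap_entries[OF lt(1) m(1), of i] ijj by simp_all
  have "overlap ?Ws m x" if "x \<in> {h, h'}" for x
    using that ov unfolding h(3) by auto
  then have ov': "overlap ?Ws m h" "overlap ?Ws m h'" by auto
  have ms: "mset ?Ws = mset Vs" using lt(1) m(1) by (rule mset_swap_entries)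
  have "tuple_cost {} ?Ws + tuple_cost {} (rev ?Ws) + 1 \<le> length ?Ws * (p + 1)"
  proof (rule tuple_cost_two_sided[OF _ _ ov' h(1,2)])
    show "count (sum_list ?Ws) t \<noteq> 1" for t
      using ent unfolding entangled_def by (metis ms sum_mset_sum_list)
    show "\<exists>j. overlap ?Ws i' j" if "i' < length ?Ws" for i'
    proof -
      have "Transposition.transpose i m i' < length Vs" using that lt m by (auto intro: transpose_less)
      then obtain j where "overlap Vs (Transposition.transpose i m i') j" using ent by (auto simp: entangled_def)
      then show ?thesis using overlap_swap_entries[OF lt(1) m(1), of "Transposition.transpose i m i'" j] by auto
    qed
    show "size V = p" if "V \<in> set ?Ws" for V
      using that p(1) ms by (metis set_mset_mset)
  qed fact
  then show thesis using lt m by (intro that[of i m]) auto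
qed

text \<open>Since the two-sided cost of an entangled tuple, after an exchange, is at most \<open>k (p + 1) - 1\<close>, one of the
  two counts has at most half of this as its exponent. Hence entangled tuples are rarer by a factor
  \<open>sqrt n\<close> than the \<open>n ^ (k (p + 1) / 2)\<close> by which the variance bound normalises. The exchange is unknown, which
  costs the factor \<open>k\<^sup>2\<close>.\<close>

lemma card_entangled_bound:
  fixes V :: "'c \<Rightarrow> 't multiset" and n :: real
  assumes C: "finite C" and n: "1 \<le> n"
    and V: "\<And>c. c \<in> C \<Longrightarrow> size (V c) = p" "even p"
    and one: "\<And>Z. finite Z \<Longrightarrow> card Z \<le> k * p \<Longrightarrow> (\<Sum>c\<in>C. (1 / n) ^ fresh_cost Z (V c)) \<le> K"
  shows "real (card {cs \<in> tuples k C. entangled (map V cs)})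
           \<le> 2 * real k ^ 2 * K ^ k * sqrt n ^ (k * (p + 1)) / sqrt n"
proof -
  define s where "s = 1 / sqrt n"
  define W where "W cs = (1 / n) ^ tuple_cost {} (map V cs) + (1 / n) ^ tuple_cost {} (rev (map V cs))" for cs
  have s: "0 < s" "s \<le> 1" "s ^ 2 = 1 / n" using n by (auto simp: s_def power_divide)
  let ?A = "{cs \<in> tuples k C. entangled (map V cs)}"
  have W0: "W cs \<ge> 0" for cs using n by (simp add: W_def)
  have sumW: "(\<Sum>cs\<in>tuples k C. W cs) \<le> 2 * K ^ k"
  proof -
    have "(\<Sum>cs\<in>tuples k C. (1 / n) ^ tuple_cost {} (rev (map V cs)))
        = (\<Sum>cs\<in>tuples k C. (1 / n) ^ tuple_cost {} (map V cs))"
      by (rule sum.reindex_bij_witness[of _ rev rev]) (auto simp: tuples_def rev_map)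
    moreover have "(\<Sum>cs\<in>tuples k C. (1 / n) ^ tuple_cost {} (map V cs)) \<le> K ^ k"
      using n V one by (intro tuple_cost_weight_bound[where p = p and z = "k * p"] C) auto
    ultimately show ?thesis by (simp add: W_def sum.distrib)
  qed
  have swap: "(\<Sum>cs\<in>tuples k C. W (swap_entries ab cs)) = (\<Sum>cs\<in>tuples k C. W cs)"
    if ab: "ab \<in> {..<k} \<times> {..<k}" for ab
  proof (rule sum.reindex_bij_witness[of _ "swap_entries ab" "swap_entries ab"])
    have *: "swap_entries ab cs \<in> tuples k C" if "cs \<in> tuples k C" for cs
      using that ab by (cases ab) (auto simp: tuples_def dest: mset_swap_entries[THEN mset_eq_setD])
    show "swap_entries ab cs \<in> tuples k C" "swap_entries ab cs \<in> tuples k C" if "cs \<in> tuples k C" for cs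
      using * that by auto
  qed (use ab in \<open>auto simp: tuples_def swap_entries_swap_entries\<close>)
  have "real (card ?A) * (s ^ (k * (p + 1)) / s) = (\<Sum>cs\<in>?A. s ^ (k * (p + 1)) / s)" by simp
  also have "\<dots> \<le> (\<Sum>cs\<in>?A. \<Sum>ab\<in>{..<k} \<times> {..<k}. W (swap_entries ab cs))"
  proof (rule sum_mono)
    fix cs assume cs: "cs \<in> ?A"
    then have len: "length cs = k" and sub: "set cs \<subseteq> C" by (auto simp: tuples_def)
    obtain a b where ab: "a < k" "b < k" and
      cost: "tuple_cost {} (swap_entries (a, b) (map V cs)) + tuple_cost {} (rev (swap_entries (a, b) (map V cs))) + 1
        \<le> k * (p + 1)" (is "?f + ?g + 1 \<le> _")
    proof -
      have "entangled (map V cs)" using cs by simp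
      moreover have "size U = p" if "U \<in> set (map V cs)" for U using that V(1) sub by auto
      ultimately show thesis
        using that len V(2) by (metis entangled_tuple_cost length_map)
    qed
    have "s ^ (k * (p + 1)) \<le> s ^ (?f + ?g + 1)" using s cost by (intro power_decreasing) auto
    then have "s ^ (k * (p + 1)) / s \<le> s ^ ?f * s ^ ?g" using s by (simp add: power_add field_simps)
    \<comment> \<open>The inequality of the means passes from the average of the two exponents to the better one.\<close>
    also have "\<dots> \<le> (s ^ ?f) ^ 2 + (s ^ ?g) ^ 2"
    proof -
      have "0 \<le> s ^ ?f * s ^ ?g" using s by simp
      then show ?thesis using sum_squares_bound[of "s ^ ?f" "s ^ ?g"] by linarith
    qed
    also have "\<dots> = W (swap_entries (a, b) cs)"
      using ab len s(3) unfolding W_def by (simp add: swap_entries_map flip: power_mult)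
        (simp add: power_mult mult.commute)
    also have "\<dots> \<le> (\<Sum>ab\<in>{..<k} \<times> {..<k}. W (swap_entries ab cs))"
      using ab W0 by (intro member_le_sum) auto
    finally show "s ^ (k * (p + 1)) / s \<le> (\<Sum>ab\<in>{..<k} \<times> {..<k}. W (swap_entries ab cs))" .
  qed
  also have "\<dots> \<le> (\<Sum>cs\<in>tuples k C. \<Sum>ab\<in>{..<k} \<times> {..<k}. W (swap_entries ab cs))"
    using C W0 by (intro sum_mono2) (auto intro!: sum_nonneg)
  also have "\<dots> = (\<Sum>ab\<in>{..<k} \<times> {..<k}. \<Sum>cs\<in>tuples k C. W (swap_entries ab cs))"
    by (rule sum.swap)
  also have "\<dots> = (\<Sum>ab\<in>{..<k} \<times> {..<k}. \<Sum>cs\<in>tuples k C. W cs)"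
    by (intro sum.cong refl swap)
  also have "\<dots> = real k ^ 2 * (\<Sum>cs\<in>tuples k C. W cs)" by (simp add: power2_eq_square)
  also have "\<dots> \<le> real k ^ 2 * (2 * K ^ k)" using sumW by (intro mult_left_mono) auto
  finally have "real (card ?A) * (s ^ (k * (p + 1)) / s) \<le> real k ^ 2 * (2 * K ^ k)" .
  then have "real (card ?A) \<le> real k ^ 2 * (2 * K ^ k) / (s ^ (k * (p + 1)) / s)"
    using s by (intro pos_le_divide_eq[THEN iffD2]) auto
  also have "\<dots> = 2 * real k ^ 2 * K ^ k * sqrt n ^ (k * (p + 1)) / sqrt n"
    using n by (simp add: s_def power_one_over field_simps)
  finally show ?thesis .
qed

section \<open>Joint moments of centred monomials\<close>

lemma sum_tuples_insert:
  assumes "j \<le> k"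
  shows "(\<Sum>cs\<in>tuples (Suc k) C. h cs) = (\<Sum>d\<in>C. \<Sum>es\<in>tuples k C. h (take j es @ d # drop j es))"
proof -
  have "(\<Sum>cs\<in>tuples (Suc k) C. h cs) = (\<Sum>(d, es)\<in>C \<times> tuples k C. h (take j es @ d # drop j es))"
  proof (rule sum.reindex_bij_witness[of _ "\<lambda>(d, es). take j es @ d # drop j es"
        "\<lambda>cs. (cs ! j, take j cs @ drop (Suc j) cs)"])
    fix cs assume cs: "cs \<in> tuples (Suc k) C"
    then have j: "j < length cs" using assms by (simp add: tuples_def)
    then have "set (take j cs @ drop (Suc j) cs) \<subseteq> C" "cs ! j \<in> C"
      using cs nth_mem[OF j] by (auto simp: tuples_def dest: in_set_takeD in_set_dropD)
    then show "(cs ! j, take j cs @ drop (Suc j) cs) \<in> C \<times> tuples k C"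
      using cs assms by (auto simp: tuples_def min_def)
    have "take j cs @ cs ! j # drop (Suc j) cs = cs" using id_take_nth_drop[OF j] by simp
    then show "(case (cs ! j, take j cs @ drop (Suc j) cs) of (d, es) \<Rightarrow> take j es @ d # drop j es) = cs"
      "(case (cs ! j, take j cs @ drop (Suc j) cs) of (d, es) \<Rightarrow> h (take j es @ d # drop j es)) = h cs"
      using j by (simp_all add: min_def)
  next
    fix b assume b: "b \<in> C \<times> tuples k C"
    obtain d es where [simp]: "b = (d, es)" by (cases b)
    show "(case b of (d, es) \<Rightarrow> take j es @ d # drop j es) \<in> tuples (Suc k) C"
      using b by (auto simp: tuples_def dest: in_set_takeD in_set_dropD)
    show "((case b of (d, es) \<Rightarrow> take j es @ d # drop j es) ! j,
        take j (case b of (d, es) \<Rightarrow> take j es @ d # drop j es) @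
        drop (Suc j) (case b of (d, es) \<Rightarrow> take j es @ d # drop j es)) = b"
      using b assms by (simp add: tuples_def nth_append min_def)
  qed
  then show ?thesis by (simp add: sum.cartesian_product)
qed

text \<open>Bounding every factor by the largest one avoids Hoelder's inequality and loses only a factor
  \<open>size A\<close>.\<close>

lemma prod_mset_le_sum_power:
  fixes f :: "'a \<Rightarrow> real"
  assumes A: "A \<noteq> {#}" and f: "\<And>t. t \<in># A \<Longrightarrow> 0 \<le> f t"
  shows "(\<Prod>t\<in>#A. f t) \<le> (\<Sum>t\<in>#A. f t ^ size A)"
proof -
  have "Max (f ` set_mset A) \<in> f ` set_mset A" using A by (intro Max_in) auto
  then obtain u where u: "u \<in># A" "f u = Max (f ` set_mset A)" by auto
  have le: "f t \<le> f u" if "t \<in># A" for t using that u(2) by simp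
  have "(\<Prod>t\<in>#B. f t) \<le> f u ^ size B \<and> 0 \<le> (\<Prod>t\<in>#B. f t)" if "B \<subseteq># A" for B
    using that
  proof (induction B)
    case (add t B)
    have "B \<subseteq># add_mset t B" by simp
    then have "B \<subseteq># A" using add.prems by (rule subset_mset.order_trans)
    moreover have "t \<in># A" using add.prems by (auto dest: mset_subset_eqD)
    ultimately show ?case using add.IH le[of t] f[of t] by (auto intro!: mult_mono)
  qed simp
  then have "(\<Prod>t\<in>#A. f t) \<le> f u ^ size A" by simp
  also have "\<dots> \<le> (\<Sum>t\<in>#A. f t ^ size A)"
  proof -
    obtain B where B: "A = add_mset u B" using u(1) by (metis mset_add)
    have "(\<Sum>t\<in>#B. 0) \<le> (\<Sum>t\<in>#B. f t ^ size A)"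
      using f unfolding B by (intro sum_mset_mono) auto
    then show ?thesis by (simp add: B)
  qed
  finally show ?thesis .
qed

lemma power_add_le: "(a + b) ^ k \<le> 2 ^ k * (a ^ k + b ^ k)" if "0 \<le> a" "0 \<le> b" for a b :: real
proof -
  have "(a + b) ^ k \<le> (2 * max a b) ^ k" using that by (intro power_mono) auto
  also have "\<dots> = 2 ^ k * max a b ^ k" by (simp add: power_mult_distrib)
  also have "max a b ^ k \<le> a ^ k + b ^ k" using that by (auto simp: max_def)
  finally show ?thesis by simp
qed

context prob_space
begin

text \<open>Unlike integrability, this property is closed under products; it settles all integrability
  questions below.\<close>

definition all_moments :: "('a \<Rightarrow> real) \<Rightarrow> bool" where
  "all_moments f \<longleftrightarrow> f \<in> borel_measurable M \<and> (\<forall>k. integrable M (\<lambda>\<omega>. \<bar>f \<omega>\<bar> ^ k))"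

lemma all_moments_measurable: "all_moments f \<Longrightarrow> f \<in> borel_measurable M"
  and all_moments_integrable_abs: "all_moments f \<Longrightarrow> integrable M (\<lambda>\<omega>. \<bar>f \<omega>\<bar> ^ k)"
  by (simp_all add: all_moments_def)

lemma all_moments_integrable: "all_moments f \<Longrightarrow> integrable M f"
  using all_moments_integrable_abs[of f 1] all_moments_measurable[of f]
  by (simp add: integrable_abs_iff)

lemma all_moments_const: "all_moments (\<lambda>_. c)"
  by (simp add: all_moments_def)

lemma all_moments_mult:
  assumes "all_moments f" "all_moments g"
  shows "all_moments (\<lambda>\<omega>. f \<omega> * g \<omega>)"
  unfolding all_moments_def
proof (intro conjI allI)
  note [measurable] = assms[THEN all_moments_measurable]
  show "(\<lambda>\<omega>. f \<omega> * g \<omega>) \<in> borel_measurable M" by measurable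
  show "integrable M (\<lambda>\<omega>. \<bar>f \<omega> * g \<omega>\<bar> ^ k)" for k
  proof (rule Bochner_Integration.integrable_bound)
    show "integrable M (\<lambda>\<omega>. \<bar>f \<omega>\<bar> ^ (2 * k) + \<bar>g \<omega>\<bar> ^ (2 * k))"
      using assms by (intro Bochner_Integration.integrable_add all_moments_integrable_abs)
    have "\<bar>u * v\<bar> ^ k \<le> \<bar>u\<bar> ^ (2 * k) + \<bar>v\<bar> ^ (2 * k)" for u v :: real
    proof -
      have "0 \<le> \<bar>u\<bar> ^ k * \<bar>v\<bar> ^ k" by simp
      then have "\<bar>u\<bar> ^ k * \<bar>v\<bar> ^ k \<le> (\<bar>u\<bar> ^ k)\<^sup>2 + (\<bar>v\<bar> ^ k)\<^sup>2"
        using sum_squares_bound[of "\<bar>u\<bar> ^ k" "\<bar>v\<bar> ^ k"] by linarith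
      then show ?thesis by (simp add: abs_mult power_mult_distrib power_mult[symmetric] mult.commute)
    qed
    then show "AE \<omega> in M. norm (\<bar>f \<omega> * g \<omega>\<bar> ^ k) \<le> norm (\<bar>f \<omega>\<bar> ^ (2 * k) + \<bar>g \<omega>\<bar> ^ (2 * k))"
      by simp
  qed measurable
qed

lemma all_moments_diff:
  assumes "all_moments f" "all_moments g"
  shows "all_moments (\<lambda>\<omega>. f \<omega> - g \<omega>)"
  unfolding all_moments_def
proof (intro conjI allI)
  note [measurable] = assms[THEN all_moments_measurable]
  show "(\<lambda>\<omega>. f \<omega> - g \<omega>) \<in> borel_measurable M" by measurable
  show "integrable M (\<lambda>\<omega>. \<bar>f \<omega> - g \<omega>\<bar> ^ k)" for k
  proof (rule Bochner_Integration.integrable_bound)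
    show "integrable M (\<lambda>\<omega>. 2 ^ k * (\<bar>f \<omega>\<bar> ^ k + \<bar>g \<omega>\<bar> ^ k))"
      using assms by (intro integrable_mult_right Bochner_Integration.integrable_add all_moments_integrable_abs)
    have "\<bar>u - v\<bar> ^ k \<le> 2 ^ k * (\<bar>u\<bar> ^ k + \<bar>v\<bar> ^ k)" for u v :: real
      by (rule order_trans[OF power_mono power_add_le]) auto
    then show "AE \<omega> in M. norm (\<bar>f \<omega> - g \<omega>\<bar> ^ k) \<le> norm (2 ^ k * (\<bar>f \<omega>\<bar> ^ k + \<bar>g \<omega>\<bar> ^ k))"
      by simp
  qed measurable
qed

lemma all_moments_add:
  "all_moments f \<Longrightarrow> all_moments g \<Longrightarrow> all_moments (\<lambda>\<omega>. f \<omega> + g \<omega>)"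
  using all_moments_diff[of f "\<lambda>\<omega>. 0 - g \<omega>"] all_moments_diff[OF all_moments_const[of 0], of g] by simp

lemma all_moments_sum:
  "(\<And>i. i \<in> A \<Longrightarrow> all_moments (f i)) \<Longrightarrow> all_moments (\<lambda>\<omega>. \<Sum>i\<in>A. f i \<omega>)"
  by (induction A rule: infinite_finite_induct) (auto intro: all_moments_const all_moments_add)

lemma all_moments_power: "all_moments f \<Longrightarrow> all_moments (\<lambda>\<omega>. f \<omega> ^ k)"
  by (induction k) (auto intro: all_moments_const all_moments_mult)

lemma all_moments_prod_mset:
  "(\<And>t. t \<in># A \<Longrightarrow> all_moments (f t)) \<Longrightarrow> all_moments (\<lambda>\<omega>. \<Prod>t\<in>#A. f t \<omega>)"
  by (induction A) (auto intro: all_moments_const all_moments_mult)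

lemma integral_sum_mset:
  fixes f :: "'b \<Rightarrow> 'a \<Rightarrow> real"
  assumes "\<And>t. t \<in># A \<Longrightarrow> integrable M (f t)"
  shows "integrable M (\<lambda>\<omega>. \<Sum>t\<in>#A. f t \<omega>)"
    and "expectation (\<lambda>\<omega>. \<Sum>t\<in>#A. f t \<omega>) = (\<Sum>t\<in>#A. expectation (f t))"
proof -
  have "integrable M (\<lambda>\<omega>. \<Sum>t\<in>#A. f t \<omega>) \<and> expectation (\<lambda>\<omega>. \<Sum>t\<in>#A. f t \<omega>) = (\<Sum>t\<in>#A. expectation (f t))"
    using assms by (induction A) auto
  then show "integrable M (\<lambda>\<omega>. \<Sum>t\<in>#A. f t \<omega>)"
    and "expectation (\<lambda>\<omega>. \<Sum>t\<in>#A. f t \<omega>) = (\<Sum>t\<in>#A. expectation (f t))" by auto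
qed

end

lemma borel_measurable_prod_mset:
  fixes f :: "'b \<Rightarrow> 'a \<Rightarrow> real"
  shows "(\<And>t. t \<in># A \<Longrightarrow> f t \<in> borel_measurable N) \<Longrightarrow> (\<lambda>y. \<Prod>t\<in>#A. f t y) \<in> borel_measurable N"
  by (induction A) auto

text \<open>The factor \<open>(\<alpha> j p) ^ (j p)\<close> is the assumed bound on the moment of order \<open>j p\<close> of one input variable; the
  rest are crude losses. The leading 1 covers the empty product.\<close>

definition moment_bound :: "real \<Rightarrow> nat \<Rightarrow> nat \<Rightarrow> real" where
  "moment_bound \<alpha> p j = 1 + real j * (2 ^ Suc j * real p ^ j * (\<alpha> * real j * real p) ^ (j * p))"

text \<open>The abstract setting: finitely many monomials of degree \<open>p\<close> in independent centred variables. For the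
  trace, the monomials are indexed by circuits and \<open>V\<close> lists their link values.\<close>

locale centred_monomials = prob_space M for M :: "'w measure" +
  fixes x :: "'t \<Rightarrow> 'w \<Rightarrow> real" and V :: "'c \<Rightarrow> 't multiset" and a :: "'c \<Rightarrow> real"
    and C :: "'c set" and p :: nat and \<alpha> :: real
  assumes indep: "indep_vars (\<lambda>_. borel) x UNIV"
    and mean: "\<And>t. expectation (x t) = 0"
    and integrable_power: "\<And>t k. k \<ge> 1 \<Longrightarrow> integrable M (\<lambda>\<omega>. \<bar>x t \<omega>\<bar> ^ k)"
    and moment: "\<And>t k. k \<ge> 1 \<Longrightarrow> expectation (\<lambda>\<omega>. \<bar>x t \<omega>\<bar> ^ k) \<le> (\<alpha> * real k) ^ k"
    and \<alpha>: "\<alpha> > 0"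
    and finite_C: "finite C"
    and size_V: "\<And>c. c \<in> C \<Longrightarrow> size (V c) = p"
    and p: "p > 0"
    and a: "\<And>c. \<bar>a c\<bar> \<le> 1"
begin

definition monomial :: "'c \<Rightarrow> ('t \<Rightarrow> real) \<Rightarrow> real" where
  "monomial c y = a c * (\<Prod>t\<in>#V c. y t)"

definition centred :: "'c \<Rightarrow> ('t \<Rightarrow> real) \<Rightarrow> real" where
  "centred c y = monomial c y - expectation (\<lambda>\<omega>. monomial c (\<lambda>t. x t \<omega>))"

definition joint :: "'c multiset \<Rightarrow> real" where
  "joint K = expectation (\<lambda>\<omega>. \<Prod>c\<in>#K. centred c (\<lambda>t. x t \<omega>))"

definition link_values :: "'c multiset \<Rightarrow> 't set" where
  "link_values K = (\<Union>c\<in>set_mset K. set_mset (V c))"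

lemma link_values_simps [simp]:
  "link_values {#} = {}" "link_values (add_mset c K) = set_mset (V c) \<union> link_values K" "link_values (K + K') = link_values K \<union> link_values K'"
  by (auto simp: link_values_def)

lemma all_moments_x: "all_moments (x t)"
proof -
  have "integrable M (\<lambda>\<omega>. \<bar>x t \<omega>\<bar> ^ k)" for k
    using integrable_power[of k t] by (cases k) auto
  then show ?thesis
    using indep by (simp add: all_moments_def indep_vars_def)
qed

lemma all_moments_monomial: "all_moments (\<lambda>\<omega>. monomial c (\<lambda>t. x t \<omega>))"
  unfolding monomial_def
  by (intro all_moments_mult all_moments_const all_moments_prod_mset all_moments_x)

lemma all_moments_centred: "all_moments (\<lambda>\<omega>. centred c (\<lambda>t. x t \<omega>))"
  unfolding centred_def by (intro all_moments_diff all_moments_const all_moments_monomial)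

lemma all_moments_prod_centred: "all_moments (\<lambda>\<omega>. \<Prod>c\<in>#K. centred c (\<lambda>t. x t \<omega>))"
  by (intro all_moments_prod_mset all_moments_centred)

text \<open>Independence is exploited through this factorisation, applied to polynomials in disjoint sets of
  variables.\<close>

lemma expectation_mult_disjoint:
  fixes f g :: "('t \<Rightarrow> real) \<Rightarrow> real"
  assumes "S \<inter> T = {}"
    and f: "f \<in> borel_measurable (PiM S (\<lambda>_. borel))" "\<And>y. f (restrict y S) = f y"
    and g: "g \<in> borel_measurable (PiM T (\<lambda>_. borel))" "\<And>y. g (restrict y T) = g y"
    and "all_moments (\<lambda>\<omega>. f (\<lambda>t. x t \<omega>))" "all_moments (\<lambda>\<omega>. g (\<lambda>t. x t \<omega>))"
  shows "expectation (\<lambda>\<omega>. f (\<lambda>t. x t \<omega>) * g (\<lambda>t. x t \<omega>)) =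
      expectation (\<lambda>\<omega>. f (\<lambda>t. x t \<omega>)) * expectation (\<lambda>\<omega>. g (\<lambda>t. x t \<omega>))"
proof -
  have "indep_var (PiM S (\<lambda>_. borel)) (\<lambda>\<omega>. restrict (\<lambda>i. x i \<omega>) S) (PiM T (\<lambda>_. borel)) (\<lambda>\<omega>. restrict (\<lambda>i. x i \<omega>) T)"
    using indep assms(1) by (rule indep_var_restrict) auto
  from indep_var_compose[OF this f(1) g(1)]
  have "indep_var borel (\<lambda>\<omega>. f (\<lambda>t. x t \<omega>)) borel (\<lambda>\<omega>. g (\<lambda>t. x t \<omega>))"
    by (simp add: comp_def f(2) g(2))
  then show ?thesis
    using assms(6,7) by (intro indep_var_lebesgue_integral all_moments_integrable)
qed

lemma measurable_monomial:
  "set_mset (V c) \<subseteq> S \<Longrightarrow> monomial c \<in> borel_measurable (PiM S (\<lambda>_. borel))"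
  unfolding monomial_def[abs_def]
  by (intro borel_measurable_times borel_measurable_const borel_measurable_prod_mset measurable_component_singleton) auto

lemma monomial_restrict: "set_mset (V c) \<subseteq> S \<Longrightarrow> monomial c (restrict y S) = monomial c y"
  unfolding monomial_def
  by (intro arg_cong2[where f = "(*)"] refl arg_cong[where f = prod_mset] image_mset_cong) auto

lemma measurable_prod_centred:
  "link_values K \<subseteq> S \<Longrightarrow> (\<lambda>y. \<Prod>c\<in>#K. centred c y) \<in> borel_measurable (PiM S (\<lambda>_. borel))"
  unfolding centred_def
  by (intro borel_measurable_prod_mset borel_measurable_diff borel_measurable_const measurable_monomial)
     (auto simp: link_values_def)

lemma prod_centred_restrict:
  "link_values K \<subseteq> S \<Longrightarrow> (\<Prod>c\<in>#K. centred c (restrict y S)) = (\<Prod>c\<in>#K. centred c y)"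
  unfolding centred_def
  by (intro arg_cong[where f = prod_mset] image_mset_cong) (auto simp: link_values_def UN_subset_iff intro!: monomial_restrict)

lemma joint_add_disjoint:
  assumes "link_values K \<inter> link_values K' = {}"
  shows "joint (K + K') = joint K * joint K'"
  unfolding joint_def
  using expectation_mult_disjoint[OF assms, of "\<lambda>y. \<Prod>c\<in>#K. centred c y" "\<lambda>y. \<Prod>c\<in>#K'. centred c y"]
  by (simp add: measurable_prod_centred prod_centred_restrict all_moments_prod_centred)

lemma joint_single: "joint {#c#} = 0"
  using all_moments_integrable[OF all_moments_monomial[of c]]
  by (simp add: joint_def centred_def prob_space)

lemma joint_isolated:
  assumes "c \<in># K" "K \<subseteq># add_mset c R" "set_mset (V c) \<inter> link_values R = {}"
  shows "joint K = 0"
proof -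
  obtain K' where K: "K = add_mset c K'" using assms(1) by (metis mset_add)
  then have "K' \<subseteq># R" using assms(2) by simp
  then have "link_values K' \<subseteq> link_values R" by (auto simp: link_values_def dest: mset_subset_eqD)
  then have "joint ({#c#} + K') = joint {#c#} * joint K'"
    using assms(3) by (intro joint_add_disjoint) auto
  then show ?thesis by (simp add: K joint_single)
qed

text \<open>If a value occurs once, its variable splits off from the product as an independent factor of mean
  zero. The subtracted mean does not interfere, because it vanishes for the same reason.\<close>

lemma joint_unmatched_value:
  assumes "count (\<Sum>c\<in>#K. V c) t = 1"
  shows "joint K = 0"
proof -
  have "t \<in># (\<Sum>c\<in>#K. V c)"
    by (subst count_greater_zero_iff[symmetric]) (use assms in linarith)
  then obtain c where c: "c \<in># K" "t \<in># V c" by auto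
  obtain K' where K: "K = add_mset c K'" using c(1) by (metis mset_add)
  obtain W where W: "V c = add_mset t W" using c(2) by (metis mset_add)
  have t0: "count W t + count (\<Sum>c\<in>#K'. V c) t = 0" using assms by (simp add: K W)
  then have tW: "t \<notin># W" by (simp add: not_in_iff)
  have tK: "t \<notin> link_values K'"
  proof -
    have "t \<notin># (\<Sum>c\<in>#K'. V c)" using t0 by (simp only: not_in_iff)
    then show ?thesis by (auto simp: link_values_def)
  qed
  define g where "g y = a c * (\<Prod>t\<in>#W. y t)" for y :: "'t \<Rightarrow> real"
  have mono: "monomial c y = y t * g y" for y by (simp add: monomial_def W g_def)
  have gm: "g \<in> borel_measurable (PiM (- {t}) (\<lambda>_. borel))"
    unfolding g_def[abs_def] using tW
    by (intro borel_measurable_times borel_measurable_const borel_measurable_prod_mset measurable_component_singleton) auto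
  have gr: "g (restrict y (- {t})) = g y" for y
    unfolding g_def using tW
    by (intro arg_cong2[where f = "(*)"] refl arg_cong[where f = prod_mset] image_mset_cong) auto
  have gi: "all_moments (\<lambda>\<omega>. g (\<lambda>t. x t \<omega>))"
    unfolding g_def by (intro all_moments_mult all_moments_const all_moments_prod_mset all_moments_x)
  have factor: "expectation (\<lambda>\<omega>. x t \<omega> * h (\<lambda>t. x t \<omega>)) = 0"
    if "h \<in> borel_measurable (PiM (- {t}) (\<lambda>_. borel))" "\<And>y. h (restrict y (- {t})) = h y"
      "all_moments (\<lambda>\<omega>. h (\<lambda>t. x t \<omega>))" for h
    using expectation_mult_disjoint[of "{t}" "- {t}" "\<lambda>y. y t" h] that all_moments_x[of t] mean[of t]
    by (simp add: measurable_component_singleton)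
  have "expectation (\<lambda>\<omega>. monomial c (\<lambda>t. x t \<omega>)) = 0"
    unfolding mono by (rule factor[OF gm gr gi])
  then have cent: "centred c y = y t * g y" for y by (simp add: centred_def mono)
  have sub: "link_values K' \<subseteq> - {t}" using tK by auto
  have "expectation (\<lambda>\<omega>. x t \<omega> * (\<lambda>y. g y * (\<Prod>c\<in>#K'. centred c y)) (\<lambda>t. x t \<omega>)) = 0"
  proof (rule factor)
    show "(\<lambda>y. g y * (\<Prod>c\<in>#K'. centred c y)) \<in> borel_measurable (PiM (- {t}) (\<lambda>_. borel))"
      by (intro borel_measurable_times gm measurable_prod_centred sub)
    show "g (restrict y (- {t})) * (\<Prod>c\<in>#K'. centred c (restrict y (- {t}))) = g y * (\<Prod>c\<in>#K'. centred c y)" for y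
      by (simp add: gr prod_centred_restrict[OF sub])
    show "all_moments (\<lambda>\<omega>. g (\<lambda>t. x t \<omega>) * (\<Prod>c\<in>#K'. centred c (\<lambda>t. x t \<omega>)))"
      by (intro all_moments_mult gi all_moments_prod_centred)
  qed
  then show ?thesis by (simp add: joint_def K cent mult.assoc)
qed

text \<open>The first step of Wick's formula, which is exact for every tuple that is not entangled. If a value
  is unmatched or a circuit is isolated, it remains so in one of the two factors of every summand, and both
  sides vanish. Otherwise every circuit has precisely one partner, only the partner of the first circuit
  contributes to the sum, and the pair is independent of the rest.\<close>

lemma joint_not_entangled:
  assumes "\<not> entangled (map V (c # ds))"
  shows "joint (mset (c # ds)) = (\<Sum>j<length ds. joint {#c, ds ! j#} * joint (mset ds - {#ds ! j#}))"
proof -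
  let ?cs = "c # ds"
  let ?Vs = "map V ?cs"
  let ?n = "length ?cs"
  have split: "mset ?cs = {#c, ds ! j#} + (mset ds - {#ds ! j#})" if "j < length ds" for j
    using that by simp
  have nth_split: "mset xs = add_mset (xs ! i) (image_mset ((!) xs) (mset_set ({..<length xs} - {i})))"
    if "i < length xs" for xs :: "'c list" and i
  proof -
    have "mset xs = image_mset ((!) xs) (mset_set {..<length xs})"
      by (metis map_nth mset_map mset_upt lessThan_atLeast0)
    also have "mset_set {..<length xs} = add_mset i (mset_set ({..<length xs} - {i}))"
      using that by (simp add: mset_set.remove)
    finally show ?thesis by simp
  qed
  consider (unmatched) t where "count (sum_list ?Vs) t = 1"
    | (isolated) i where "i < ?n" "\<And>j. \<not> overlap ?Vs i j"
    | (paired) "\<And>i. i < ?n \<Longrightarrow> \<exists>j. overlap ?Vs i j"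
        "\<And>i j j'. overlap ?Vs i j \<Longrightarrow> overlap ?Vs i j' \<Longrightarrow> j = j'"
    using assms unfolding entangled_def length_map by blast
  then show ?thesis
  proof cases
    case unmatched
    have sum: "sum_list ?Vs = (\<Sum>c\<in>#mset ?cs. V c)" by (simp add: sum_mset_sum_list[symmetric])
    have "joint {#c, ds ! j#} * joint (mset ds - {#ds ! j#}) = 0" if "j < length ds" for j
    proof -
      have "count (\<Sum>c\<in>#{#c, ds ! j#}. V c) t + count (\<Sum>c\<in>#mset ds - {#ds ! j#}. V c) t = 1"
        using unmatched unfolding sum split[OF that] by simp
      then consider "count (\<Sum>c\<in>#{#c, ds ! j#}. V c) t = 1" | "count (\<Sum>c\<in>#mset ds - {#ds ! j#}. V c) t = 1"
        by linarith
      then show ?thesis by cases (simp_all only: joint_unmatched_value mult_zero_left mult_zero_right)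
    qed
    moreover have "joint (mset ?cs) = 0"
      using unmatched unfolding sum by (rule joint_unmatched_value)
    ultimately show ?thesis by (simp add: sum.neutral del: mult_eq_0_iff)
  next
    case isolated
    define R where "R = image_mset ((!) ?cs) (mset_set ({..<?n} - {i}))"
    have ms: "mset ?cs = add_mset (?cs ! i) R" unfolding R_def using isolated(1) by (rule nth_split)
    have dis: "set_mset (V (?cs ! i)) \<inter> link_values R = {}"
    proof -
      have "set_mset (V (?cs ! i)) \<inter> set_mset (V (?cs ! j)) = {}" if "j < ?n" "j \<noteq> i" for j
        using isolated(1) isolated(2)[of j] that unfolding overlap_def length_map by (simp only: nth_map) auto
      then show ?thesis unfolding link_values_def R_def by fastforce
    qed
    have "joint {#c, ds ! j#} * joint (mset ds - {#ds ! j#}) = 0" if j: "j < length ds" for j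
    proof -
      have sub: "{#c, ds ! j#} \<subseteq># add_mset (?cs ! i) R" "mset ds - {#ds ! j#} \<subseteq># add_mset (?cs ! i) R"
        unfolding ms[symmetric] split[OF j] by (rule mset_subset_eq_add_left, rule mset_subset_eq_add_right)
      have "?cs ! i \<in># {#c, ds ! j#} + (mset ds - {#ds ! j#})"
        unfolding split[OF j, symmetric] ms by simp
      then consider "?cs ! i \<in># {#c, ds ! j#}" | "?cs ! i \<in># mset ds - {#ds ! j#}"
        by (auto simp del: nth_Cons_Suc)
      then show ?thesis
        using joint_isolated[OF _ sub(1) dis] joint_isolated[OF _ sub(2) dis] by cases simp_all
    qed
    moreover have "joint (mset ?cs) = 0"
      by (rule joint_isolated[OF _ _ dis]) (simp_all only: ms, simp_all)
    ultimately show ?thesis by (simp add: sum.neutral del: mult_eq_0_iff)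
  next
    case paired
    obtain j0 where j0: "overlap ?Vs 0 j0" using paired(1)[of 0] by auto
    then obtain j where j: "j0 = Suc j" "j < length ds" by (cases j0) (auto simp: overlap_def)
    have dis0: "set_mset (V c) \<inter> set_mset (V (ds ! i)) = {}" if "i < length ds" "i \<noteq> j" for i
    proof -
      have "\<not> overlap ?Vs 0 (Suc i)" using paired(2)[OF j0, of "Suc i"] that j by auto
      then show ?thesis using that by (simp add: overlap_def)
    qed
    have disj: "set_mset (V (ds ! j)) \<inter> set_mset (V (ds ! i)) = {}" if "i < length ds" "i \<noteq> j" for i
    proof -
      have "overlap ?Vs (Suc j) 0" using j0 j overlap_sym by metis
      then have "\<not> overlap ?Vs (Suc j) (Suc i)" using paired(2) by blast
      then show ?thesis using that j by (simp add: overlap_def)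
    qed
    have rest: "mset ds - {#ds ! j#} = image_mset ((!) ds) (mset_set ({..<length ds} - {j}))"
      using nth_split[OF j(2)] by simp
    have "joint (mset ?cs) = joint {#c, ds ! j#} * joint (mset ds - {#ds ! j#})"
      unfolding split[OF j(2)]
    proof (rule joint_add_disjoint)
      show "link_values {#c, ds ! j#} \<inter> link_values (mset ds - {#ds ! j#}) = {}"
        unfolding rest using dis0 disj by (fastforce simp: link_values_def)
    qed
    moreover have "joint {#c, ds ! i#} = 0" if "i < length ds" "i \<noteq> j" for i
      using dis0[OF that] by (intro joint_isolated[of c _ "{#ds ! i#}"]) auto
    ultimately show ?thesis
      using j(2) by (simp add: sum.remove[of "{..<length ds}" j])
  qed
qed



lemma expectation_monomial_power_le:
  assumes c: "c \<in> C" and j: "j \<ge> 1"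
  shows "expectation (\<lambda>\<omega>. \<bar>monomial c (\<lambda>t. x t \<omega>)\<bar> ^ j) \<le> real p * (\<alpha> * real j * real p) ^ (j * p)"
proof -
  have int: "integrable M (\<lambda>\<omega>. \<bar>x t \<omega>\<bar> ^ (j * p))" for t
    by (rule all_moments_integrable_abs[OF all_moments_x])
  have ptw: "\<bar>monomial c y\<bar> ^ j \<le> (\<Sum>t\<in>#V c. \<bar>y t\<bar> ^ (j * p))" for y
  proof -
    have abs_prod: "\<bar>\<Prod>t\<in>#A. y t\<bar> ^ j = (\<Prod>t\<in>#A. \<bar>y t\<bar> ^ j)" for A
      by (induction A) (auto simp: abs_mult power_mult_distrib)
    have "\<bar>monomial c y\<bar> ^ j = \<bar>a c\<bar> ^ j * (\<Prod>t\<in>#V c. \<bar>y t\<bar> ^ j)"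
      by (simp add: monomial_def abs_mult power_mult_distrib abs_prod)
    also have "\<dots> \<le> 1 * (\<Prod>t\<in>#V c. \<bar>y t\<bar> ^ j)"
      using a[of c] by (intro mult_right_mono power_le_one) (auto simp: abs_prod[symmetric])
    also have "(\<Prod>t\<in>#V c. \<bar>y t\<bar> ^ j) \<le> (\<Sum>t\<in>#V c. (\<bar>y t\<bar> ^ j) ^ size (V c))"
      using size_V[OF c] p by (intro prod_mset_le_sum_power) auto
    finally show ?thesis by (simp add: size_V[OF c] power_mult)
  qed
  have "expectation (\<lambda>\<omega>. \<bar>monomial c (\<lambda>t. x t \<omega>)\<bar> ^ j) \<le> expectation (\<lambda>\<omega>. \<Sum>t\<in>#V c. \<bar>x t \<omega>\<bar> ^ (j * p))"
    using ptw int by (intro integral_mono integral_sum_mset(1) all_moments_integrable_abs all_moments_monomial all_moments_x) auto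
  also have "\<dots> = (\<Sum>t\<in>#V c. expectation (\<lambda>\<omega>. \<bar>x t \<omega>\<bar> ^ (j * p)))"
    using int by (rule integral_sum_mset)
  also have "\<dots> \<le> (\<Sum>t\<in>#V c. (\<alpha> * real j * real p) ^ (j * p))"
    using moment[of "j * p"] j p by (intro sum_mset_mono) (simp add: mult.assoc)
  also have "\<dots> = real p * (\<alpha> * real j * real p) ^ (j * p)" by (simp add: size_V[OF c])
  finally show ?thesis .
qed

lemma expectation_centred_power_le:
  assumes c: "c \<in> C" and j: "j \<ge> 1"
  shows "expectation (\<lambda>\<omega>. \<bar>centred c (\<lambda>t. x t \<omega>)\<bar> ^ j) \<le>
           2 ^ Suc j * real p ^ j * (\<alpha> * real j * real p) ^ (j * p)"
proof -
  let ?X = "\<lambda>\<omega>. monomial c (\<lambda>t. x t \<omega>)"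
  let ?b = "real p ^ j * (\<alpha> * real j * real p) ^ (j * p)"
  have X: "integrable M (\<lambda>\<omega>. \<bar>?X \<omega>\<bar> ^ j)" by (rule all_moments_integrable_abs[OF all_moments_monomial])
  have p1: "1 \<le> real p" using p by simp
  have 1: "expectation (\<lambda>\<omega>. \<bar>?X \<omega>\<bar> ^ j) \<le> ?b"
  proof (rule order_trans[OF expectation_monomial_power_le[OF c j]])
    show "real p * (\<alpha> * real j * real p) ^ (j * p) \<le> ?b"
      using p1 j \<alpha> self_le_power[OF p1, of j] by (intro mult_right_mono) auto
  qed
  have 2: "\<bar>expectation ?X\<bar> ^ j \<le> ?b"
  proof -
    have "\<bar>expectation ?X\<bar> \<le> expectation (\<lambda>\<omega>. \<bar>?X \<omega>\<bar>)" by (rule integral_abs_bound)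
    also have "\<dots> \<le> real p * (\<alpha> * real p) ^ p"
      using expectation_monomial_power_le[OF c, of 1] by simp
    also have "\<dots> \<le> real p * (\<alpha> * real j * real p) ^ p"
      using \<alpha> j p1 by (intro mult_left_mono power_mono mult_right_mono) auto
    finally have "\<bar>expectation ?X\<bar> ^ j \<le> (real p * (\<alpha> * real j * real p) ^ p) ^ j"
      by (intro power_mono) auto
    then show ?thesis by (simp add: power_mult_distrib power_mult[symmetric] mult.commute[of p j])
  qed
  have "expectation (\<lambda>\<omega>. \<bar>centred c (\<lambda>t. x t \<omega>)\<bar> ^ j) \<le>
      expectation (\<lambda>\<omega>. 2 ^ j * (\<bar>?X \<omega>\<bar> ^ j + \<bar>expectation ?X\<bar> ^ j))"
  proof (rule integral_mono)
    show "integrable M (\<lambda>\<omega>. 2 ^ j * (\<bar>?X \<omega>\<bar> ^ j + \<bar>expectation ?X\<bar> ^ j))" using X by simp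
    show "\<bar>centred c (\<lambda>t. x t \<omega>)\<bar> ^ j \<le> 2 ^ j * (\<bar>?X \<omega>\<bar> ^ j + \<bar>expectation ?X\<bar> ^ j)" for \<omega>
      unfolding centred_def by (rule order_trans[OF power_mono power_add_le]) auto
  qed (rule all_moments_integrable_abs[OF all_moments_centred])
  also have "\<dots> = 2 ^ j * (expectation (\<lambda>\<omega>. \<bar>?X \<omega>\<bar> ^ j) + \<bar>expectation ?X\<bar> ^ j)"
    using X by (simp add: prob_space)
  also have "\<dots> \<le> 2 ^ j * (?b + ?b)" by (rule mult_left_mono[OF add_mono[OF 1 2]]) simp
  finally show ?thesis by (simp add: mult.assoc)
qed

lemma moment_bound_ge_1: "1 \<le> moment_bound \<alpha> p j"
  using \<alpha> by (simp add: moment_bound_def)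

lemma joint_le_moment_bound:
  assumes K: "set_mset K \<subseteq> C"
  shows "\<bar>joint K\<bar> \<le> moment_bound \<alpha> p (size K)"
proof (cases "K = {#}")
  case True
  then show ?thesis by (simp add: joint_def prob_space moment_bound_def)
next
  case False
  let ?Y = "\<lambda>c \<omega>. centred c (\<lambda>t. x t \<omega>)"
  have int: "integrable M (\<lambda>\<omega>. \<bar>?Y c \<omega>\<bar> ^ size K)" for c
    by (rule all_moments_integrable_abs[OF all_moments_centred])
  have abs_prod: "\<bar>\<Prod>c\<in>#A. ?Y c \<omega>\<bar> = (\<Prod>c\<in>#A. \<bar>?Y c \<omega>\<bar>)" for A \<omega>
    by (induction A) (auto simp: abs_mult)
  have "\<bar>joint K\<bar> \<le> expectation (\<lambda>\<omega>. \<bar>\<Prod>c\<in>#K. ?Y c \<omega>\<bar>)"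
    unfolding joint_def by (rule integral_abs_bound)
  also have "\<dots> \<le> expectation (\<lambda>\<omega>. \<Sum>c\<in>#K. \<bar>?Y c \<omega>\<bar> ^ size K)"
  proof (rule integral_mono)
    show "integrable M (\<lambda>\<omega>. \<bar>\<Prod>c\<in>#K. ?Y c \<omega>\<bar>)"
      by (rule integrable_abs[OF all_moments_integrable[OF all_moments_prod_centred]])
    show "\<bar>\<Prod>c\<in>#K. ?Y c \<omega>\<bar> \<le> (\<Sum>c\<in>#K. \<bar>?Y c \<omega>\<bar> ^ size K)" for \<omega>
      unfolding abs_prod using False by (intro prod_mset_le_sum_power) auto
  qed (rule integral_sum_mset(1)[OF int])
  also have "\<dots> = (\<Sum>c\<in>#K. expectation (\<lambda>\<omega>. \<bar>?Y c \<omega>\<bar> ^ size K))"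
    using int by (rule integral_sum_mset)
  also have "\<dots> \<le> (\<Sum>c\<in>#K. 2 ^ Suc (size K) * real p ^ size K * (\<alpha> * real (size K) * real p) ^ (size K * p))"
    using K False
    by (intro sum_mset_mono expectation_centred_power_le) (auto simp: Suc_le_eq nonempty_has_size)
  finally show ?thesis by (simp add: moment_bound_def)
qed

definition total :: "'w \<Rightarrow> real" where
  "total \<omega> = (\<Sum>c\<in>C. centred c (\<lambda>t. x t \<omega>))"

lemma total_power: "total \<omega> ^ k = (\<Sum>cs\<in>tuples k C. \<Prod>c\<in>#mset cs. centred c (\<lambda>t. x t \<omega>))"
  unfolding total_def sum_power_tuples by (simp add: prod_mset_prod_list[symmetric])

lemma expectation_total_power: "expectation (\<lambda>\<omega>. total \<omega> ^ k) = (\<Sum>cs\<in>tuples k C. joint (mset cs))"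
  unfolding total_power joint_def
  by (intro Bochner_Integration.integral_sum all_moments_integrable all_moments_prod_centred)

lemma expectation_total: "expectation total = 0"
  using expectation_total_power[of 1] by (simp add: sum_tuples_Suc joint_single)

text \<open>Summing the first step of Wick's formula over all tuples turns it into the recursion for Gaussian
  moments: each of the \<open>k + 1\<close> possible positions of the partner contributes the same product of the second
  moment and the moment of order \<open>k\<close>. Only entangled tuples contribute to the error.\<close>

lemma moment_recursion_error:
  "\<bar>expectation (\<lambda>\<omega>. total \<omega> ^ Suc (Suc k)) - real (Suc k) * expectation (\<lambda>\<omega>. total \<omega> ^ 2) * expectation (\<lambda>\<omega>. total \<omega> ^ k)\<bar>
     \<le> real (card {cs \<in> tuples (Suc (Suc k)) C. entangled (map V cs)}) *
         (moment_bound \<alpha> p (Suc (Suc k)) + real (Suc k) * (moment_bound \<alpha> p 2 * moment_bound \<alpha> p k))"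
proof -
  define f where "f c ds = (\<Sum>j<Suc k. joint {#c, ds ! j#} * joint (mset ds - {#ds ! j#}))" for c ds
  let ?n = "Suc (Suc k)"
  let ?A = "{cs \<in> tuples ?n C. entangled (map V cs)}"
  let ?d = "\<lambda>cs. joint (mset cs) - f (hd cs) (tl cs)"
  let ?m = "moment_bound \<alpha> p ?n + real (Suc k) * (moment_bound \<alpha> p 2 * moment_bound \<alpha> p k)"
  have "(\<Sum>cs\<in>tuples ?n C. f (hd cs) (tl cs)) =
      (\<Sum>c\<in>C. \<Sum>j<Suc k. \<Sum>ds\<in>tuples (Suc k) C. joint {#c, ds ! j#} * joint (mset ds - {#ds ! j#}))"
    unfolding sum_tuples_Suc[of _ "Suc k"] f_def list.sel by (intro sum.cong refl sum.swap)
  also have "\<dots> = (\<Sum>c\<in>C. \<Sum>j<Suc k. \<Sum>d\<in>C. \<Sum>es\<in>tuples k C. joint {#c, d#} * joint (mset es))"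
  proof (intro sum.cong refl)
    fix c j assume "j \<in> {..<Suc k}"
    then have j: "j \<le> k" by simp
    have "mset (take j es) + mset (drop j es) = mset es" for es :: "'c list"
      by (metis append_take_drop_id mset_append)
    then show "(\<Sum>ds\<in>tuples (Suc k) C. joint {#c, ds ! j#} * joint (mset ds - {#ds ! j#})) =
        (\<Sum>d\<in>C. \<Sum>es\<in>tuples k C. joint {#c, d#} * joint (mset es))"
      unfolding sum_tuples_insert[OF j] using j
      by (intro sum.cong refl) (simp add: tuples_def nth_append min_def)
  qed
  also have "\<dots> = real (Suc k) * ((\<Sum>c\<in>C. \<Sum>d\<in>C. joint {#c, d#}) * (\<Sum>es\<in>tuples k C. joint (mset es)))"
    by (simp add: sum_distrib_left[symmetric] sum_distrib_right[symmetric] del: of_nat_Suc)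
  also have "(\<Sum>c\<in>C. \<Sum>d\<in>C. joint {#c, d#}) = expectation (\<lambda>\<omega>. total \<omega> ^ 2)"
    unfolding expectation_total_power numeral_2_eq_2 by (simp add: sum_tuples_Suc)
  also have "(\<Sum>es\<in>tuples k C. joint (mset es)) = expectation (\<lambda>\<omega>. total \<omega> ^ k)"
    by (rule expectation_total_power[symmetric])
  finally have main: "(\<Sum>cs\<in>tuples ?n C. f (hd cs) (tl cs)) =
      real (Suc k) * expectation (\<lambda>\<omega>. total \<omega> ^ 2) * expectation (\<lambda>\<omega>. total \<omega> ^ k)"
    by (simp only: mult.assoc)
  have zero: "?d cs = 0" if "cs \<in> tuples ?n C" "\<not> entangled (map V cs)" for cs
  proof -
    obtain c ds where cs: "cs = c # ds" "length ds = Suc k"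
      using \<open>cs \<in> tuples ?n C\<close> by (cases cs) (auto simp: tuples_def)
    then show ?thesis using joint_not_entangled[of c ds] that by (simp add: f_def del: mset.simps)
  qed
  have bound: "\<bar>?d cs\<bar> \<le> ?m" if "cs \<in> tuples ?n C" for cs
  proof -
    obtain c ds where cs: "cs = c # ds" "length ds = Suc k" "c \<in> C" "set ds \<subseteq> C"
      using \<open>cs \<in> tuples ?n C\<close> by (cases cs) (auto simp: tuples_def)
    have "\<bar>joint {#c, ds ! j#} * joint (mset ds - {#ds ! j#})\<bar> \<le> moment_bound \<alpha> p 2 * moment_bound \<alpha> p k"
      if j: "j < Suc k" for j
    proof -
      have mem: "ds ! j \<in> set ds" using j cs by simp
      have "set_mset (mset ds - {#ds ! j#}) \<subseteq> set_mset (mset ds)" by (intro set_mset_mono diff_subset_eq_self)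
      then have sub: "set_mset (mset ds - {#ds ! j#}) \<subseteq> C" using cs by simp
      have "\<bar>joint {#c, ds ! j#}\<bar> \<le> moment_bound \<alpha> p 2" "\<bar>joint (mset ds - {#ds ! j#})\<bar> \<le> moment_bound \<alpha> p k"
        using joint_le_moment_bound[of "{#c, ds ! j#}"] joint_le_moment_bound[OF sub] cs mem
        by (auto simp: numeral_2_eq_2 size_Diff_singleton)
      then show ?thesis
        unfolding abs_mult using moment_bound_ge_1[of 2] by (intro mult_mono) auto
    qed
    then have "\<bar>f c ds\<bar> \<le> (\<Sum>j<Suc k. moment_bound \<alpha> p 2 * moment_bound \<alpha> p k)"
      unfolding f_def by (intro order_trans[OF sum_abs] sum_mono) auto
    then have "\<bar>f c ds\<bar> \<le> real (Suc k) * (moment_bound \<alpha> p 2 * moment_bound \<alpha> p k)" by simp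
    moreover have "\<bar>joint (mset cs)\<bar> \<le> moment_bound \<alpha> p ?n"
      using joint_le_moment_bound[of "mset cs"] cs by simp
    ultimately show ?thesis unfolding cs(1) list.sel by linarith
  qed
  have "expectation (\<lambda>\<omega>. total \<omega> ^ ?n) - real (Suc k) * expectation (\<lambda>\<omega>. total \<omega> ^ 2) * expectation (\<lambda>\<omega>. total \<omega> ^ k)
      = (\<Sum>cs\<in>tuples ?n C. ?d cs)"
    unfolding expectation_total_power[of ?n] main[symmetric] sum_subtractf ..
  also have "\<dots> = (\<Sum>cs\<in>?A. ?d cs)"
    using zero finite_C by (intro sum.mono_neutral_right) auto
  also have "\<bar>\<dots>\<bar> \<le> (\<Sum>cs\<in>?A. ?m)"
    using bound by (intro order_trans[OF sum_abs] sum_mono) auto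
  finally show ?thesis by simp
qed

end

section \<open>Traces of matrix powers as sums over circuits\<close>

definition circuit_weight :: "('a \<Rightarrow> 'a \<Rightarrow> 'b::comm_monoid_mult) \<Rightarrow> 'a list \<Rightarrow> 'b" where
  "circuit_weight w xs = (\<Prod>(u, v)\<leftarrow>zip xs (rotate1 xs). w u v)"

fun walk_weight :: "('a \<Rightarrow> 'a \<Rightarrow> 'b::comm_monoid_mult) \<Rightarrow> 'a \<Rightarrow> 'a list \<Rightarrow> 'a \<Rightarrow> 'b" where
  "walk_weight w u [] v = w u v"
| "walk_weight w u (x # xs) v = w u x * walk_weight w x xs v"

lemma walk_weight_eq_prod: "walk_weight w u xs v = (\<Prod>(a, b)\<leftarrow>zip (u # xs) (xs @ [v]). w a b)"
  by (induction xs arbitrary: u) auto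

lemma walk_weight_eq_circuit_weight: "walk_weight w u xs u = circuit_weight w (u # xs)"
  by (simp add: walk_weight_eq_prod circuit_weight_def)

lemma pow_mat_Suc_left:
  fixes A :: "'a::semiring_1 mat"
  assumes A: "A \<in> carrier_mat n n"
  shows "A ^\<^sub>m Suc k = A * A ^\<^sub>m k"
proof (induction k)
  case 0
  then show ?case using A by simp
next
  case (Suc k)
  have "A ^\<^sub>m Suc (Suc k) = (A * A ^\<^sub>m k) * A" using Suc by simp
  also have "\<dots> = A * (A ^\<^sub>m k * A)" by (rule assoc_mult_mat[OF A pow_carrier_mat[OF A] A])
  finally show ?case by simp
qed

lemma pow_mat_eq_sum_walks:
  fixes A :: "'a::comm_semiring_1 mat"
  assumes A: "A \<in> carrier_mat n n" and "i < n" "j < n"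
  shows "(A ^\<^sub>m Suc k) $$ (i, j) = (\<Sum>xs\<in>tuples k {..<n}. walk_weight (\<lambda>u v. A $$ (u, v)) i xs j)"
  using assms(2,3)
proof (induction k arbitrary: i)
  case 0
  then show ?case using A by simp
next
  case (Suc k)
  have "(A ^\<^sub>m Suc (Suc k)) $$ (i, j) = (\<Sum>u<n. A $$ (i, u) * (A ^\<^sub>m Suc k) $$ (u, j))"
  proof -
    have "A ^\<^sub>m Suc k \<in> carrier_mat n n" by (rule pow_carrier_mat[OF A])
    then show ?thesis
      using Suc.prems A unfolding pow_mat_Suc_left[OF A, of "Suc k"]
      by (auto simp: times_mat_def scalar_prod_def lessThan_atLeast0 simp del: pow_mat.simps intro!: sum.cong)
  qed
  also have "\<dots> = (\<Sum>u<n. A $$ (i, u) * (\<Sum>xs\<in>tuples k {..<n}. walk_weight (\<lambda>u v. A $$ (u, v)) u xs j))"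
    using Suc by (intro sum.cong) (auto simp del: pow_mat.simps)
  finally show ?case by (simp add: sum_tuples_Suc sum_distrib_left)
qed

lemma mat_trace_pow_eq_sum_circuits:
  fixes A :: "'a::comm_semiring_1 mat"
  assumes A: "A \<in> carrier_mat n n" and p: "p > 0"
  shows "mat_trace (A ^\<^sub>m p) = (\<Sum>xs\<in>tuples p {..<n}. circuit_weight (\<lambda>u v. A $$ (u, v)) xs)"
proof -
  obtain k where k: "p = Suc k" using p by (cases p) auto
  have "mat_trace (A ^\<^sub>m p) = (\<Sum>i<n. (A ^\<^sub>m Suc k) $$ (i, i))"
    using A unfolding k mat_trace_def by (simp del: pow_mat.simps)
  also have "\<dots> = (\<Sum>i<n. \<Sum>xs\<in>tuples k {..<n}. walk_weight (\<lambda>u v. A $$ (u, v)) i xs i)"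
    using pow_mat_eq_sum_walks[OF A] by (intro sum.cong) (auto simp del: pow_mat.simps)
  finally show ?thesis by (simp add: k sum_tuples_Suc walk_weight_eq_circuit_weight)
qed

text \<open>The indicator of \<open>\<Delta>\<close> only contributes a coefficient 0 or 1 to each circuit. Matrix indices start at 0,
  hence the shifts.\<close>

lemma trace_power_eq_sum_circuits:
  fixes L :: "nat \<Rightarrow> nat \<Rightarrow> int ^ 'd"
  assumes p: "p > 0"
  shows "trace_power N L \<Delta> p x \<omega> = (1 / sqrt (real N)) ^ p *
    (\<Sum>xs\<in>tuples p {..<N}. circuit_weight (\<lambda>u v. of_bool ((Suc u, Suc v) \<in> \<Delta>)) xs *
       (\<Prod>t\<in>#circuit_values (\<lambda>u v. L (Suc u) (Suc v)) xs. x t \<omega>))"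
proof -
  let ?s = "1 / sqrt (real N)"
  let ?w = "\<lambda>u v. ?s * (of_bool ((Suc u, Suc v) \<in> \<Delta>) * x (L (Suc u) (Suc v)) \<omega>)"
  let ?A = "?s \<cdot>\<^sub>m patterned_matrix N L \<Delta> (\<lambda>t. x t \<omega>)"
  have A: "?A \<in> carrier_mat N N" by (simp add: patterned_matrix_def)
  have "trace_power N L \<Delta> p x \<omega> = (\<Sum>xs\<in>tuples p {..<N}. circuit_weight (\<lambda>u v. ?A $$ (u, v)) xs)"
    unfolding trace_power_def by (rule mat_trace_pow_eq_sum_circuits[OF A p])
  also have "\<dots> = (\<Sum>xs\<in>tuples p {..<N}. circuit_weight ?w xs)"
  proof (rule sum.cong)
    fix xs assume "xs \<in> tuples p {..<N}"
    then have "set xs \<subseteq> {..<N}" by (simp add: tuples_def)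
    then have "u < N" "v < N" if "(u, v) \<in> set (zip xs (rotate1 xs))" for u v
      using that set_zip_leftD[OF that] set_zip_rightD[OF that] by auto
    then show "circuit_weight (\<lambda>u v. ?A $$ (u, v)) xs = circuit_weight ?w xs"
      unfolding circuit_weight_def
      by (intro arg_cong[where f = prod_list] map_cong) (auto simp: patterned_matrix_def)
  qed simp
  finally have sum: "trace_power N L \<Delta> p x \<omega> = (\<Sum>xs\<in>tuples p {..<N}. circuit_weight ?w xs)" .
  have "circuit_weight ?w xs = ?s ^ length xs * (circuit_weight (\<lambda>u v. of_bool ((Suc u, Suc v) \<in> \<Delta>)) xs *
       (\<Prod>t\<in>#circuit_values (\<lambda>u v. L (Suc u) (Suc v)) xs. x t \<omega>))" for xs
  proof -
    have "(\<Prod>(u, v)\<leftarrow>es. ?w u v) = ?s ^ length es * ((\<Prod>(u, v)\<leftarrow>es. of_bool ((Suc u, Suc v) \<in> \<Delta>)) *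
       (\<Prod>t\<in>#image_mset (\<lambda>(u, v). L (Suc u) (Suc v)) (mset es). x t \<omega>))" for es
      by (induction es) (auto simp: algebra_simps)
    from this[of "zip xs (rotate1 xs)"] show ?thesis
      by (simp add: circuit_weight_def circuit_values_def)
  qed
  then show ?thesis
    unfolding sum sum_distrib_left by (intro sum.cong) (auto simp: tuples_def)
qed

lemma circuit_weight_of_bool_le_1:
  "\<bar>circuit_weight (\<lambda>u v. of_bool (P u v)) xs :: real\<bar> \<le> 1"
proof -
  have "0 \<le> (\<Prod>(u, v)\<leftarrow>es. of_bool (P u v) :: real) \<and> (\<Prod>(u, v)\<leftarrow>es. of_bool (P u v) :: real) \<le> 1" for es
    by (induction es) (auto simp: mult_le_one)
  then show ?thesis by (simp add: circuit_weight_def abs_le_iff)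
qed

section \<open>Method of moments for the Gaussian law\<close>

lemma char_moment_bound:
  assumes M: "real_distribution M" and M': "real_distribution M'"
    and I: "\<And>k. integrable M (\<lambda>x. x ^ k)" and I': "\<And>k. integrable M' (\<lambda>x. x ^ k)"
  shows "cmod (char M t - char M' t) \<le>
    (\<Sum>k\<le>2 * m. \<bar>t\<bar> ^ k / fact k * \<bar>(LINT x|M. x ^ k) - (LINT x|M'. x ^ k)\<bar>)
      + 2 * \<bar>t\<bar> ^ (2 * m) / fact (2 * m) * ((LINT x|M. x ^ (2 * m)) + (LINT x|M'. x ^ (2 * m)))"
proof -
  interpret M: real_distribution M by fact
  interpret M': real_distribution M' by fact
  let ?P = "\<lambda>M. \<Sum>k\<le>2 * m. (\<i> * complex_of_real t) ^ k / fact k * complex_of_real (LINT x|M. x ^ k)"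
  have 1: "cmod (char M t - ?P M) \<le> 2 * \<bar>t\<bar> ^ (2 * m) / fact (2 * m) * (LINT x|M. x ^ (2 * m))"
    using M.char_approx1[of "2 * m" t] I by (simp add: power_even_abs)
  have 2: "cmod (char M' t - ?P M') \<le> 2 * \<bar>t\<bar> ^ (2 * m) / fact (2 * m) * (LINT x|M'. x ^ (2 * m))"
    using M'.char_approx1[of "2 * m" t] I' by (simp add: power_even_abs)
  have "?P M - ?P M' = (\<Sum>k\<le>2 * m. (\<i> * complex_of_real t) ^ k / fact k *
      complex_of_real ((LINT x|M. x ^ k) - (LINT x|M'. x ^ k)))"
    by (simp add: sum_subtractf algebra_simps)
  also have "cmod \<dots> \<le> (\<Sum>k\<le>2 * m. \<bar>t\<bar> ^ k / fact k * \<bar>(LINT x|M. x ^ k) - (LINT x|M'. x ^ k)\<bar>)"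
    by (rule order_trans[OF norm_sum], rule sum_mono)
       (simp add: norm_mult norm_divide norm_power del: of_real_diff)
  finally have 3: "cmod (?P M - ?P M') \<le> (\<Sum>k\<le>2 * m. \<bar>t\<bar> ^ k / fact k * \<bar>(LINT x|M. x ^ k) - (LINT x|M'. x ^ k)\<bar>)" .
  have tri: "cmod (a - d) \<le> cmod (a - b) + cmod (b - c) + cmod (d - c)" for a b c d
    using norm_triangle_ineq[of "a - b" "b - c"] norm_triangle_ineq4[of "a - c" "d - c"] by simp
  have "cmod (char M t - char M' t) \<le> cmod (char M t - ?P M) + cmod (?P M - ?P M') + cmod (char M' t - ?P M')"
    by (rule tri)
  also have "\<dots> \<le> 2 * \<bar>t\<bar> ^ (2 * m) / fact (2 * m) * (LINT x|M. x ^ (2 * m)) +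
      (\<Sum>k\<le>2 * m. \<bar>t\<bar> ^ k / fact k * \<bar>(LINT x|M. x ^ k) - (LINT x|M'. x ^ k)\<bar>) +
      2 * \<bar>t\<bar> ^ (2 * m) / fact (2 * m) * (LINT x|M'. x ^ (2 * m))"
    by (rule add_mono[OF add_mono[OF 1 3] 2])
  finally show ?thesis by (simp only: distrib_left ac_simps)
qed

text \<open>The method of moments. The Taylor remainder of order \<open>2 m\<close> of the characteristic function is controlled by
  the moment of order \<open>2 m\<close>, whose Gaussian limit is \<open>(2 m)! / (2 ^ m m!)\<close>; so the remainder is of order
  \<open>(t\<^sup>2 / 2) ^ m / m!\<close> and can be made small by the choice of \<open>m\<close> before \<open>n\<close> tends to infinity.\<close>

lemma weak_conv_std_normal_if_moments_tendsto:
  fixes \<mu> :: "nat \<Rightarrow> real measure"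
  assumes \<mu>: "\<And>n. real_distribution (\<mu> n)"
    and I: "\<And>n k. integrable (\<mu> n) (\<lambda>x. x ^ k)"
    and moments: "\<And>k. (\<lambda>n. LINT x|\<mu> n. x ^ k) \<longlonglongrightarrow> (LINT x|std_normal_distribution. x ^ k)"
  shows "weak_conv_m \<mu> std_normal_distribution"
proof (rule levy_continuity[OF \<mu> real_dist_normal_dist])
  fix t :: real
  let ?G = "\<lambda>k. LINT x|std_normal_distribution. x ^ k"
  have tail: "(\<lambda>m. 2 * \<bar>t\<bar> ^ (2 * m) / fact (2 * m) * (2 * ?G (2 * m))) \<longlonglongrightarrow> 0"
  proof -
    have "(\<lambda>m. 4 * ((t ^ 2 / 2) ^ m / fact m)) \<longlonglongrightarrow> 4 * 0"
      by (intro tendsto_intros) (rule summable_LIMSEQ_zero, use summable_exp[of "t ^ 2 / 2"] in \<open>simp add: field_simps\<close>)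
    moreover have "\<bar>t\<bar> ^ (2 * m) = (t ^ 2) ^ m" for m by (simp add: power_mult)
    then have "2 * \<bar>t\<bar> ^ (2 * m) / fact (2 * m) * (2 * ?G (2 * m)) = 4 * ((t ^ 2 / 2) ^ m / fact m)" for m
      unfolding std_normal_distribution_even_moments(1) by (simp add: power_divide)
    ultimately show ?thesis by simp
  qed
  show "(\<lambda>n. char (\<mu> n) t) \<longlonglongrightarrow> char std_normal_distribution t"
  proof (rule Lim_null[THEN iffD2], rule tendstoI)
    fix e :: real assume e: "e > 0"
    obtain m where m: "\<bar>2 * \<bar>t\<bar> ^ (2 * m) / fact (2 * m) * (2 * ?G (2 * m))\<bar> < e"
      using tendstoD[OF tail e] by (auto simp: eventually_sequentially)
    define b where "b n = (\<Sum>k\<le>2 * m. \<bar>t\<bar> ^ k / fact k * \<bar>(LINT x|\<mu> n. x ^ k) - ?G k\<bar>)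
      + 2 * \<bar>t\<bar> ^ (2 * m) / fact (2 * m) * ((LINT x|\<mu> n. x ^ (2 * m)) + ?G (2 * m))" for n
    have "b \<longlonglongrightarrow> (\<Sum>k\<le>2 * m. \<bar>t\<bar> ^ k / fact k * \<bar>?G k - ?G k\<bar>)
      + 2 * \<bar>t\<bar> ^ (2 * m) / fact (2 * m) * (?G (2 * m) + ?G (2 * m))"
      unfolding b_def by (intro tendsto_intros moments)
    moreover have "(\<Sum>k\<le>2 * m. \<bar>t\<bar> ^ k / fact k * \<bar>?G k - ?G k\<bar>)
      + 2 * \<bar>t\<bar> ^ (2 * m) / fact (2 * m) * (?G (2 * m) + ?G (2 * m)) < e" using m by simp
    ultimately have "eventually (\<lambda>n. b n < e) sequentially" by (rule order_tendstoD(2))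
    then show "eventually (\<lambda>n. dist (char (\<mu> n) t - char std_normal_distribution t) 0 < e) sequentially"
    proof eventually_elim
      case (elim n)
      have "cmod (char (\<mu> n) t - char std_normal_distribution t) \<le> b n"
        unfolding b_def
        by (rule char_moment_bound[OF \<mu> real_dist_normal_dist I integrable_std_normal_distribution_moment])
      with elim show ?case by simp
    qed
  qed
qed

lemma std_normal_moment_recursion:
  "(LINT x|std_normal_distribution. x ^ Suc (Suc k)) = real (Suc k) * (LINT x|std_normal_distribution. x ^ k)"
proof (cases "even k")
  case True
  then obtain j where k: "k = 2 * j" by auto
  have "(LINT x|std_normal_distribution. x ^ Suc (Suc k)) = (LINT x|std_normal_distribution. x ^ (2 * Suc j))"
    unfolding k by simp
  also have "\<dots> = fact (2 * Suc j) / (2 ^ Suc j * fact (Suc j))"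
    by (rule std_normal_distribution_even_moments(1))
  also have "fact (2 * Suc j) = (2 * real (Suc j)) * (real (Suc k) * fact (2 * j))"
    unfolding k by (simp add: algebra_simps)
  also have "2 ^ Suc j * fact (Suc j) = (2 * real (Suc j)) * (2 ^ j * fact j)"
    by (simp add: algebra_simps)
  also have "(2 * real (Suc j)) * (real (Suc k) * fact (2 * j)) / ((2 * real (Suc j)) * (2 ^ j * fact j)) =
      real (Suc k) * (fact (2 * j) / (2 ^ j * fact j))"
    by simp
  finally show ?thesis unfolding k std_normal_distribution_even_moments(1) .
next
  case False
  then show ?thesis
    using integral_std_normal_distribution_moment_odd[of k] integral_std_normal_distribution_moment_odd[of "Suc (Suc k)"]
    by (simp del: power_Suc)
qed

section \<open>Subpolynomial growth\<close>

text \<open>The growth class \<open>N ^ o(1)\<close>. The condition on \<open>p\<close> yields \<open>p ln p = o(ln N)\<close>, so that all combinatorial and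
  moment factors, which grow at most like \<open>(C p) ^ (C p)\<close> for a constant \<open>C\<close>, belong to this class.\<close>

definition subpolynomial :: "(nat \<Rightarrow> nat) \<Rightarrow> (nat \<Rightarrow> real) \<Rightarrow> bool" where
  "subpolynomial N f \<longleftrightarrow> (\<forall>\<epsilon>>0. eventually (\<lambda>n. \<bar>f n\<bar> \<le> real (N n) powr \<epsilon>) sequentially)"

context
  fixes N :: "nat \<Rightarrow> nat"
  assumes N: "filterlim N at_top sequentially"
begin

lemma real_N_at_top: "filterlim (\<lambda>n. real (N n)) at_top sequentially"
  using N filterlim_real_sequentially by (rule filterlim_compose[rotated])

lemma subpolynomial_if_eventually_le:
  "subpolynomial N g \<Longrightarrow> eventually (\<lambda>n. \<bar>f n\<bar> \<le> \<bar>g n\<bar>) sequentially \<Longrightarrow> subpolynomial N f"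
  unfolding subpolynomial_def by (auto elim: eventually_elim2)

lemma subpolynomial_mult:
  assumes "subpolynomial N f" "subpolynomial N g"
  shows "subpolynomial N (\<lambda>n. f n * g n)"
  unfolding subpolynomial_def
proof (intro allI impI)
  fix \<epsilon> :: real assume "\<epsilon> > 0"
  then have "eventually (\<lambda>n. \<bar>f n\<bar> \<le> real (N n) powr (\<epsilon> / 2)) sequentially"
    "eventually (\<lambda>n. \<bar>g n\<bar> \<le> real (N n) powr (\<epsilon> / 2)) sequentially"
    using assms by (simp_all add: subpolynomial_def)
  then show "eventually (\<lambda>n. \<bar>f n * g n\<bar> \<le> real (N n) powr \<epsilon>) sequentially"
  proof eventually_elim
    case (elim n)
    then have "\<bar>f n * g n\<bar> \<le> real (N n) powr (\<epsilon> / 2) * real (N n) powr (\<epsilon> / 2)"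
      unfolding abs_mult by (intro mult_mono) auto
    also have "\<dots> = real (N n) powr \<epsilon>" by (simp flip: powr_add)
    finally show ?case .
  qed
qed

lemma subpolynomial_const: "subpolynomial N (\<lambda>_. C)"
  unfolding subpolynomial_def
proof (intro allI impI)
  fix \<epsilon> :: real assume e: "\<epsilon> > 0"
  have "eventually (\<lambda>n. (\<bar>C\<bar> + 1) powr (1 / \<epsilon>) \<le> real (N n)) sequentially"
    using real_N_at_top unfolding filterlim_at_top by blast
  then show "eventually (\<lambda>n. \<bar>C\<bar> \<le> real (N n) powr \<epsilon>) sequentially"
  proof eventually_elim
    case (elim n)
    have "\<bar>C\<bar> + 1 = ((\<bar>C\<bar> + 1) powr (1 / \<epsilon>)) powr \<epsilon>" using e by (simp add: powr_powr)
    also have "\<dots> \<le> real (N n) powr \<epsilon>" using elim e by (intro powr_mono2) auto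
    finally show ?case by simp
  qed
qed

lemma subpolynomial_power: "subpolynomial N f \<Longrightarrow> subpolynomial N (\<lambda>n. f n ^ k)"
  by (induction k) (auto intro: subpolynomial_const subpolynomial_mult)

lemma subpolynomial_add:
  assumes "subpolynomial N f" "subpolynomial N g"
  shows "subpolynomial N (\<lambda>n. f n + g n)"
proof (rule subpolynomial_if_eventually_le)
  show "subpolynomial N (\<lambda>n. (1 + 1) * ((1 + \<bar>f n\<bar>) * (1 + \<bar>g n\<bar>)))"
  proof -
    have one: "subpolynomial N (\<lambda>n. 1 + \<bar>f n\<bar>)" if f: "subpolynomial N f" for f
      unfolding subpolynomial_def
    proof (intro allI impI)
      fix \<epsilon> :: real assume e: "\<epsilon> > 0"
      have "eventually (\<lambda>n. \<bar>f n\<bar> \<le> real (N n) powr (\<epsilon> / 2)) sequentially"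
        "eventually (\<lambda>n. \<bar>2\<bar> \<le> real (N n) powr (\<epsilon> / 2)) sequentially"
        using e f subpolynomial_const[of 2] by (auto simp: subpolynomial_def)
      then show "eventually (\<lambda>n. \<bar>1 + \<bar>f n\<bar>\<bar> \<le> real (N n) powr \<epsilon>) sequentially"
      proof eventually_elim
        case (elim n)
        let ?r = "real (N n) powr (\<epsilon> / 2)"
        have "\<bar>1 + \<bar>f n\<bar>\<bar> \<le> ?r + ?r" using elim by simp
        also have "\<dots> \<le> ?r * ?r" using elim mult_right_mono[of 2 ?r ?r] by simp
        also have "\<dots> = real (N n) powr \<epsilon>" by (simp flip: powr_add)
        finally show ?case .
      qed
    qed
    show ?thesis by (intro subpolynomial_mult one assms) (simp add: subpolynomial_const)
  qed
  have "\<bar>u + v\<bar> \<le> \<bar>(1 + 1) * ((1 + \<bar>u\<bar>) * (1 + \<bar>v\<bar>))\<bar>" for u v :: real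
  proof -
    have "0 \<le> \<bar>u\<bar> * \<bar>v\<bar>" by simp
    moreover have "\<bar>(1 + 1) * ((1 + \<bar>u\<bar>) * (1 + \<bar>v\<bar>))\<bar> = 2 + 2 * \<bar>u\<bar> + 2 * \<bar>v\<bar> + 2 * (\<bar>u\<bar> * \<bar>v\<bar>)"
      by (simp add: abs_of_nonneg algebra_simps)
    ultimately show ?thesis using abs_triangle_ineq[of u v] abs_ge_zero[of u] abs_ge_zero[of v] by linarith
  qed
  then show "eventually (\<lambda>n. \<bar>f n + g n\<bar> \<le> \<bar>(1 + 1) * ((1 + \<bar>f n\<bar>) * (1 + \<bar>g n\<bar>))\<bar>) sequentially"
    by simp
qed

lemma subpolynomial_imp_tendsto_0:
  assumes "subpolynomial N f"
  shows "(\<lambda>n. f n / sqrt (real (N n))) \<longlonglongrightarrow> 0"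
proof (rule Lim_null_comparison)
  have "eventually (\<lambda>n. \<bar>f n\<bar> \<le> real (N n) powr (1 / 4)) sequentially"
    using assms by (simp add: subpolynomial_def)
  moreover have "eventually (\<lambda>n. N n \<ge> 1) sequentially"
    using N by (simp add: filterlim_at_top)
  ultimately show "eventually (\<lambda>n. norm (f n / sqrt (real (N n))) \<le> real (N n) powr (- (1 / 4))) sequentially"
  proof eventually_elim
    case (elim n)
    have "norm (f n / sqrt (real (N n))) \<le> real (N n) powr (1 / 4) / real (N n) powr (1 / 2)"
      using elim by (simp add: powr_half_sqrt divide_right_mono)
    also have "\<dots> = real (N n) powr (- (1 / 4))" by (simp flip: powr_diff)
    finally show ?case .
  qed
  show "(\<lambda>n. real (N n) powr (- (1 / 4))) \<longlonglongrightarrow> 0"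
    using tendsto_neg_powr[OF _ real_N_at_top, of "- (1 / 4)"] by simp
qed

context
  fixes p :: "nat \<Rightarrow> nat"
  assumes p: "(\<lambda>n. real (p n)) \<in> o(\<lambda>n. ln (real (N n)) / ln (ln (real (N n))))"
begin

lemma subpolynomial_p_power_p: "subpolynomial N (\<lambda>n. (real (p n) + 3) ^ p n)"
  unfolding subpolynomial_def
proof (intro allI impI)
  fix \<epsilon> :: real assume e: "\<epsilon> > 0"
  define \<delta> where "\<delta> = min 1 (\<epsilon> / 2)"
  have d: "0 < \<delta>" "\<delta> \<le> 1" "2 * \<delta> \<le> \<epsilon>" using e by (auto simp: \<delta>_def)
  have "filterlim (\<lambda>n. ln (real (N n))) at_top sequentially"
    by (rule filterlim_compose[OF ln_at_top real_N_at_top])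
  then have 1: "eventually (\<lambda>n. ln (real (N n)) \<ge> 4) sequentially" by (simp add: filterlim_at_top)
  have 2: "eventually (\<lambda>n. norm (real (p n)) \<le> \<delta> * norm (ln (real (N n)) / ln (ln (real (N n))))) sequentially"
    using landau_o.smallD[OF p d(1)] .
  show "eventually (\<lambda>n. \<bar>(real (p n) + 3) ^ p n\<bar> \<le> real (N n) powr \<epsilon>) sequentially"
    using 1 2
  proof eventually_elim
    case (elim n)
    define l where "l = ln (real (N n))"
    have l: "l \<ge> 4" using elim l_def by simp
    have N0: "real (N n) > 0" using l unfolding l_def by (cases "N n = 0") auto
    have e4: "exp 1 \<le> (4 :: real)" using exp_le by simp
    have ll: "ln l \<ge> 1" using l e4 by (subst ln_ge_iff) auto
    have p1: "real (p n) \<le> \<delta> * (l / ln l)" using elim l ll by (simp add: l_def)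
    \<comment> \<open>Already \<open>p \<le> ln N\<close> gives \<open>ln (p + 3) \<le> 2 ln (ln N)\<close>, which cancels the denominator in the bound on \<open>p\<close>.\<close>
    have "\<delta> * (l / ln l) \<le> 1 * (l / 1)"
      using d l ll by (intro mult_mono frac_le) auto
    then have "real (p n) + 3 \<le> l * l"
    proof -
      have "l + 3 \<le> 4 * l" "4 * l \<le> l * l" using l by (auto intro: mult_right_mono)
      then show ?thesis using p1 \<open>\<delta> * (l / ln l) \<le> 1 * (l / 1)\<close> by linarith
    qed
    then have "ln (real (p n) + 3) \<le> ln (l * l)" using l by (intro ln_mono) auto
    also have "\<dots> = 2 * ln l" using l by (simp add: ln_mult)
    finally have "real (p n) * ln (real (p n) + 3) \<le> \<delta> * (l / ln l) * (2 * ln l)"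
      using p1 l ll d by (intro mult_mono) auto
    also have "\<dots> = 2 * \<delta> * l" using ll by simp
    also have "\<dots> \<le> \<epsilon> * l" using d l by (intro mult_right_mono) auto
    finally have "real (p n) * ln (real (p n) + 3) \<le> \<epsilon> * l" .
    then have "exp (real (p n) * ln (real (p n) + 3)) \<le> exp (\<epsilon> * l)" by simp
    moreover have "exp (real (p n) * ln (real (p n) + 3)) = (real (p n) + 3) ^ p n"
      by (simp add: exp_of_nat_mult)
    ultimately show ?case using N0 by (simp add: powr_def l_def)
  qed
qed

lemma subpolynomial_exp_p: "subpolynomial N (\<lambda>n. C ^ p n)"
proof -
  have base: "subpolynomial N (\<lambda>n. 3 ^ p n)"
    by (rule subpolynomial_if_eventually_le[OF subpolynomial_p_power_p]) (auto intro!: always_eventually power_mono)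
  obtain k where k: "\<bar>C\<bar> < 3 ^ k" using real_arch_pow[of 3 "\<bar>C\<bar>"] by auto
  have "\<bar>C ^ p n\<bar> \<le> \<bar>(3 ^ p n) ^ k\<bar>" for n
  proof -
    have "\<bar>C ^ p n\<bar> \<le> (3 ^ k) ^ p n" using k unfolding power_abs by (intro power_mono) auto
    then show ?thesis by (simp flip: power_mult add: mult.commute)
  qed
  then show ?thesis
    by (intro subpolynomial_if_eventually_le[OF subpolynomial_power[OF base, of k]]) auto
qed

lemma subpolynomial_linear_power_p:
  assumes "u \<ge> 0" "v \<ge> 0"
  shows "subpolynomial N (\<lambda>n. (u + v * real (p n)) ^ p n)"
proof (rule subpolynomial_if_eventually_le)
  show "subpolynomial N (\<lambda>n. (u + v) ^ p n * (real (p n) + 3) ^ p n)"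
    by (intro subpolynomial_mult subpolynomial_exp_p subpolynomial_p_power_p)
  have "u + v * real (p n) \<le> (u + v) * (real (p n) + 3)" for n
    using assms by (simp add: algebra_simps)
  then have "(u + v * real (p n)) ^ p n \<le> ((u + v) * (real (p n) + 3)) ^ p n" for n
    using assms by (intro power_mono) auto
  then show "eventually (\<lambda>n. \<bar>(u + v * real (p n)) ^ p n\<bar> \<le> \<bar>(u + v) ^ p n * (real (p n) + 3) ^ p n\<bar>) sequentially"
    using assms by (simp add: power_mult_distrib)
qed

lemma subpolynomial_p: "subpolynomial N (\<lambda>n. real (p n))"
proof (rule subpolynomial_if_eventually_le)
  show "subpolynomial N (\<lambda>n. 2 ^ p n)" by (rule subpolynomial_exp_p)
  show "eventually (\<lambda>n. \<bar>real (p n)\<bar> \<le> \<bar>2 ^ p n\<bar>) sequentially"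
    using of_nat_less_two_power by (intro always_eventually) (auto intro: less_imp_le)
qed

end
end

section \<open>Gaussian fluctuations of the trace\<close>

lemma (in prob_space) all_moments_trace_power:
  assumes x: "\<And>t. all_moments (x t)"
  shows "all_moments (trace_power N L \<Delta> p x)"
proof (cases "p = 0")
  case True
  have "trace_power N L \<Delta> p x = (\<lambda>_. mat_trace (1\<^sub>m N))"
    by (auto simp: True trace_power_def patterned_matrix_def)
  then show ?thesis by (simp add: all_moments_const)
next
  case False
  then have "p > 0" by simp
  note eq = trace_power_eq_sum_circuits[OF this, of N L \<Delta> x]
  show ?thesis
    unfolding eq[abs_def]
    by (intro all_moments_mult all_moments_const all_moments_sum all_moments_prod_mset x)
qed

text \<open>The bound on the number of entangled tuples, divided by the lower bound on the standard deviation to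
  the power \<open>k + 2\<close> and multiplied by the bound on a single summand; the powers of \<open>N\<close> cancel up to \<open>1 / sqrt N\<close>.\<close>

definition recursion_error :: "real \<Rightarrow> real \<Rightarrow> real \<Rightarrow> nat \<Rightarrow> nat \<Rightarrow> real" where
  "recursion_error B \<alpha> c k p =
     2 * real (Suc (Suc k)) ^ 2 *
     (real (p + 1) * (1 + B * (real (Suc (Suc k)) + 1) * real p) ^ p) ^ Suc (Suc k) *
     ((1 / sqrt c) ^ p) ^ Suc (Suc k) *
     (moment_bound \<alpha> p (Suc (Suc k)) + real (Suc k) * (moment_bound \<alpha> p 2 * moment_bound \<alpha> p k))"

lemma subpolynomial_recursion_error:
  assumes N: "filterlim N at_top sequentially"
    and p: "(\<lambda>n. real (p n)) \<in> o(\<lambda>n. ln (real (N n)) / ln (ln (real (N n))))"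
    and "B \<ge> 0" "\<alpha> > 0"
  shows "subpolynomial N (\<lambda>n. recursion_error B \<alpha> c k (p n))"
proof -
  note intros = subpolynomial_mult[OF N] subpolynomial_add[OF N] subpolynomial_const[OF N]
    subpolynomial_power[OF N] subpolynomial_p[OF N p] subpolynomial_exp_p[OF N p]
  have lin: "subpolynomial N (\<lambda>n. (u + v * real (p n)) ^ p n)" if "u \<ge> 0" "v \<ge> 0" for u v
    using subpolynomial_linear_power_p[OF N p that] .
  have mb: "subpolynomial N (\<lambda>n. moment_bound \<alpha> (p n) j)" for j
  proof -
    have "subpolynomial N (\<lambda>n. 1 + real j * (2 ^ Suc j * real (p n) ^ j * ((0 + (\<alpha> * real j) * real (p n)) ^ p n) ^ j))"
      using assms by (intro intros lin) auto
    moreover have "(\<alpha> * real j * real q) ^ (j * q) = ((0 + (\<alpha> * real j) * real q) ^ q) ^ j" for q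
      by (simp add: power_mult[symmetric] mult.commute)
    ultimately show ?thesis unfolding moment_bound_def by simp
  qed
  show ?thesis
    unfolding recursion_error_def of_nat_add using assms by (intro intros lin mb) auto
qed

text \<open>For fixed \<open>n\<close> the normalised trace satisfies the Gaussian moment recursion up to an explicit error. The
  powers of \<open>N\<close> balance exactly because the variance bound makes the standard deviation of the sum over
  circuits at least \<open>sqrt c ^ p * sqrt N ^ (p + 1)\<close>.\<close>

lemma (in prob_space) normalized_trace_moments:
  fixes x :: "int ^ 'd \<Rightarrow> 'a \<Rightarrow> real" and N p :: nat and B \<alpha> c :: real
  assumes N: "N \<ge> 1" and p_pos: "p > 0" and p_even: "even p"
    and L_bound: "\<And>t k. k \<in> {1..N} \<Longrightarrow> real (card {l \<in> {1..N}. L k l = t}) \<le> B"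
    and x_indep: "indep_vars (\<lambda>_. borel) x UNIV"
    and x_mean: "\<And>i. expectation (x i) = 0"
    and \<alpha>: "\<alpha> > 0"
    and x_integrable: "\<And>i k. k \<ge> 1 \<Longrightarrow> integrable M (\<lambda>\<omega>. \<bar>x i \<omega>\<bar> ^ k)"
    and x_moment: "\<And>i k. k \<ge> 1 \<Longrightarrow> expectation (\<lambda>\<omega>. \<bar>x i \<omega>\<bar> ^ k) \<le> (\<alpha> * real k) ^ k"
    and c: "c > 0"
    and var_lower: "c ^ p * real N \<le> variance (trace_power N L \<Delta> p x)"
  defines "\<eta> \<equiv> \<lambda>\<omega>. (trace_power N L \<Delta> p x \<omega> - expectation (trace_power N L \<Delta> p x)) / sqrt (variance (trace_power N L \<Delta> p x))"
  shows "expectation \<eta> = 0"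
    and "\<bar>expectation (\<lambda>\<omega>. \<eta> \<omega> ^ Suc (Suc k)) - real (Suc k) * expectation (\<lambda>\<omega>. \<eta> \<omega> ^ k)\<bar>
           \<le> recursion_error B \<alpha> c k p / sqrt (real N)"
proof -
  let ?L = "\<lambda>u v. L (Suc u) (Suc v)"
  let ?T = "trace_power N L \<Delta> p x"
  interpret centred_monomials M x "circuit_values ?L"
    "circuit_weight (\<lambda>u v. of_bool ((Suc u, Suc v) \<in> \<Delta>))" "tuples p {..<N}" p \<alpha>
  proof unfold_locales
    show "size (circuit_values ?L xs) = p" if "xs \<in> tuples p {..<N}" for xs
      using that by (simp add: tuples_def)
    show "\<bar>circuit_weight (\<lambda>u v. of_bool ((Suc u, Suc v) \<in> \<Delta>)) xs\<bar> \<le> (1 :: real)" for xs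
      by (rule circuit_weight_of_bool_le_1)
    show "finite (tuples p {..<N})" by simp
  qed (fact x_indep x_mean x_integrable x_moment \<alpha> p_pos)+
  let ?C = "tuples p {..<N}"
  let ?s = "(1 / sqrt (real N)) ^ p"
  have s: "?s > 0" using N by simp
  have T: "?T \<omega> = ?s * (\<Sum>xs\<in>?C. monomial xs (\<lambda>t. x t \<omega>))" for \<omega>
    unfolding trace_power_eq_sum_circuits[OF p_pos] monomial_def ..
  have ET: "expectation ?T = ?s * (\<Sum>xs\<in>?C. expectation (\<lambda>\<omega>. monomial xs (\<lambda>t. x t \<omega>)))"
    unfolding T using all_moments_integrable[OF all_moments_monomial] by simp
  have centred_T: "?T \<omega> - expectation ?T = ?s * total \<omega>" for \<omega>
    unfolding ET T total_def centred_def by (simp add: sum_subtractf right_diff_distrib)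
  define v where "v = expectation (\<lambda>\<omega>. total \<omega> ^ 2)"
  have var: "variance ?T = ?s ^ 2 * v"
    unfolding centred_T v_def power_mult_distrib by simp
  have v_lower: "(sqrt c ^ p * sqrt (real N) ^ (p + 1)) ^ 2 \<le> v"
  proof -
    have "c ^ p * real N \<le> ?s ^ 2 * v" using var_lower var by simp
    also have "?s ^ 2 = 1 / real N ^ p"
      using N by (simp add: power_mult[symmetric] mult.commute[of p] power_mult power_one_over)
    finally have "c ^ p * real N * real N ^ p \<le> v" using N by (simp add: field_simps)
    moreover have "(sqrt c ^ p * sqrt (real N) ^ (p + 1)) ^ 2 = (sqrt c ^ 2) ^ p * (sqrt (real N) ^ 2) ^ (p + 1)"
      unfolding power_mult_distrib by (simp only: power_mult[symmetric] mult.commute)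
    ultimately show ?thesis using c by (simp add: mult.assoc)
  qed
  have low: "0 < sqrt c ^ p * sqrt (real N) ^ (p + 1)" using c N by simp
  have v: "0 < v" using low v_lower by (meson less_le_trans zero_less_power)
  define \<sigma> where "\<sigma> = sqrt v"
  have \<sigma>: "0 < \<sigma>" "\<sigma> ^ 2 = v" using v by (auto simp: \<sigma>_def)
  have \<sigma>_lower: "sqrt c ^ p * sqrt (real N) ^ (p + 1) \<le> \<sigma>"
    unfolding \<sigma>_def using v_lower by (rule real_le_rsqrt)
  have \<eta>: "\<eta> = (\<lambda>\<omega>. total \<omega> / \<sigma>)"
  proof -
    have "sqrt (variance ?T) = ?s * \<sigma>"
      unfolding var \<sigma>_def real_sqrt_mult using s by simp
    then have "\<eta> = (\<lambda>\<omega>. (?T \<omega> - expectation ?T) / (?s * \<sigma>))" by (simp only: \<eta>_def)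
    then show ?thesis using N unfolding centred_T by simp
  qed
  show "expectation \<eta> = 0" unfolding \<eta> using expectation_total by simp
  let ?k = "Suc (Suc k)"
  let ?ent = "real (card {cs \<in> tuples ?k ?C. entangled (map (circuit_values ?L) cs)})"
  let ?mb = "moment_bound \<alpha> p ?k + real (Suc k) * (moment_bound \<alpha> p 2 * moment_bound \<alpha> p k)"
  let ?K = "real (p + 1) * (1 + B * (real ?k + 1) * real p) ^ p"
  have mb0: "0 \<le> ?mb"
    using moment_bound_ge_1[of ?k] moment_bound_ge_1[of 2] moment_bound_ge_1[of k]
    by (intro add_nonneg_nonneg mult_nonneg_nonneg) auto
  have moment_\<eta>: "expectation (\<lambda>\<omega>. \<eta> \<omega> ^ j) = expectation (\<lambda>\<omega>. total \<omega> ^ j) / \<sigma> ^ j" for j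
    unfolding \<eta> by (simp add: power_divide)
  have ent: "?ent \<le> 2 * real ?k ^ 2 * ?K ^ ?k * sqrt (real N) ^ (?k * (p + 1)) / sqrt (real N)"
  proof (rule card_entangled_bound)
    have L': "real (card {u \<in> {..<N}. ?L v u = t}) \<le> B" if "v \<in> {..<N}" for v t
    proof -
      have "card {u \<in> {..<N}. ?L v u = t} = card {l \<in> {1..N}. L (Suc v) l = t}"
        by (rule bij_betw_same_card[of Suc], rule bij_betw_byWitness[of _ "\<lambda>l. l - 1"]) auto
      then show ?thesis using L_bound[of "Suc v" t] that by simp
    qed
    have B0: "0 \<le> B" using order_trans[OF of_nat_0_le_iff L'[of 0 "?L 0 0"]] N by simp
    show "(\<Sum>cs\<in>?C. (1 / real N) ^ fresh_cost Z (circuit_values ?L cs)) \<le> ?K"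
      if Z: "finite Z" "card Z \<le> ?k * p" for Z
    proof -
      have "B * real (card Z + p) \<le> B * real (?k * p + p)"
        using Z(2) B0 by (intro mult_left_mono) (simp_all only: of_nat_le_iff add_le_cancel_right)
      also have "\<dots> = B * (real ?k + 1) * real p" by (simp add: algebra_simps)
      finally have "B * real (card Z + p) \<le> B * (real ?k + 1) * real p" .
      then show ?thesis
        using circuit_weight_bound[of "{..<N}" ?L B Z p, OF _ _ L' Z(1) _ p_pos] N by (simp add: lessThan_empty_iff)
    qed
    show "size (circuit_values ?L xs) = p" if "xs \<in> ?C" for xs using that by (rule size_V)
  qed (use N p_even in simp_all)
  have "\<bar>expectation (\<lambda>\<omega>. \<eta> \<omega> ^ ?k) - real (Suc k) * expectation (\<lambda>\<omega>. \<eta> \<omega> ^ k)\<bar> =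
      \<bar>expectation (\<lambda>\<omega>. total \<omega> ^ ?k) - real (Suc k) * v * expectation (\<lambda>\<omega>. total \<omega> ^ k)\<bar> / \<sigma> ^ ?k"
  proof -
    have "expectation (\<lambda>\<omega>. \<eta> \<omega> ^ ?k) - real (Suc k) * expectation (\<lambda>\<omega>. \<eta> \<omega> ^ k) =
      (expectation (\<lambda>\<omega>. total \<omega> ^ ?k) - real (Suc k) * v * expectation (\<lambda>\<omega>. total \<omega> ^ k)) / \<sigma> ^ ?k"
      unfolding moment_\<eta> \<sigma>(2)[symmetric] using \<sigma>(1) by (simp add: field_simps power2_eq_square)
    then show ?thesis using \<sigma>(1) by (simp only: abs_divide) simp
  qed
  also have "\<dots> \<le> ?ent * ?mb / \<sigma> ^ ?k"
    using moment_recursion_error[of k] \<sigma>(1) by (intro divide_right_mono) (auto simp: v_def)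
  also have "\<dots> \<le> (2 * real ?k ^ 2 * ?K ^ ?k * sqrt (real N) ^ (?k * (p + 1)) / sqrt (real N)) * ?mb /
      (sqrt c ^ p * sqrt (real N) ^ (p + 1)) ^ ?k"
  proof (rule frac_le)
    show "0 \<le> 2 * real ?k ^ 2 * ?K ^ ?k * sqrt (real N) ^ (?k * (p + 1)) / sqrt (real N) * ?mb"
      using ent mb0 by (intro mult_nonneg_nonneg) (auto intro: order_trans[OF of_nat_0_le_iff])
    show "?ent * ?mb \<le> 2 * real ?k ^ 2 * ?K ^ ?k * sqrt (real N) ^ (?k * (p + 1)) / sqrt (real N) * ?mb"
      using ent mb0 by (rule mult_right_mono)
    show "0 < (sqrt c ^ p * sqrt (real N) ^ (p + 1)) ^ ?k" using low by (rule zero_less_power)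
    show "(sqrt c ^ p * sqrt (real N) ^ (p + 1)) ^ ?k \<le> \<sigma> ^ ?k"
      using \<sigma>_lower low by (intro power_mono) auto
  qed
  also have "\<dots> = recursion_error B \<alpha> c k p / sqrt (real N)"
  proof -
    have *: "(u * w / r) * m / (g * w) = u * (1 / g) * m / r" if "w \<noteq> 0" "g \<noteq> 0" for u w r m g :: real
      using that by (simp add: field_simps)
    have split: "(sqrt c ^ p * sqrt (real N) ^ (p + 1)) ^ ?k = (sqrt c ^ p) ^ ?k * sqrt (real N) ^ (?k * (p + 1))"
      by (simp only: power_mult_distrib power_mult[symmetric] mult.commute)
    have inv: "1 / (sqrt c ^ p) ^ ?k = ((1 / sqrt c) ^ p) ^ ?k"
      by (simp only: power_one_over)
    have "(2 * real ?k ^ 2 * ?K ^ ?k * sqrt (real N) ^ (?k * (p + 1)) / sqrt (real N)) * ?mb /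
        (sqrt c ^ p * sqrt (real N) ^ (p + 1)) ^ ?k =
        2 * real ?k ^ 2 * ?K ^ ?k * (1 / (sqrt c ^ p) ^ ?k) * ?mb / sqrt (real N)"
      unfolding split by (rule *) (use c N in simp_all)
    then show ?thesis unfolding inv recursion_error_def .
  qed
  finally show "\<bar>expectation (\<lambda>\<omega>. \<eta> \<omega> ^ Suc (Suc k)) - real (Suc k) * expectation (\<lambda>\<omega>. \<eta> \<omega> ^ k)\<bar>
           \<le> recursion_error B \<alpha> c k p / sqrt (real N)" .
qed

theorem theorem1:
  fixes M :: "'w measure"
    and x :: "int ^ 'd \<Rightarrow> 'w \<Rightarrow> real"
    and N p :: "nat \<Rightarrow> nat"
    and L :: "nat \<Rightarrow> nat \<Rightarrow> nat \<Rightarrow> int ^ 'd"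
    and \<Delta> :: "nat \<Rightarrow> (nat \<times> nat) set"
    and B \<alpha> c :: real
  assumes M: "prob_space M"
    and N_mono: "strict_mono_on {1..} N"
    and L_sym: "\<And>n i j. n \<ge> 1 \<Longrightarrow> i \<in> {1..N n} \<Longrightarrow> j \<in> {1..N n} \<Longrightarrow> L n i j = L n j i"
    and \<Delta>_subset: "\<And>n. n \<ge> 1 \<Longrightarrow> \<Delta> n \<subseteq> {1..N n} \<times> {1..N n}"
    and \<Delta>_sym: "\<And>n i j. n \<ge> 1 \<Longrightarrow> (i, j) \<in> \<Delta> n \<Longrightarrow> (j, i) \<in> \<Delta> n"
    and p_pos: "\<And>n. n \<ge> 1 \<Longrightarrow> p n > 0"
    and p_even: "\<And>n. n \<ge> 1 \<Longrightarrow> even (p n)"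
    and p_small: "(\<lambda>n. real (p n)) \<in> o(\<lambda>n. ln (real (N n)) / ln (ln (real (N n))))"
    and L_bound: "\<And>n t k. n \<ge> 1 \<Longrightarrow> k \<in> {1..N n} \<Longrightarrow>
                    real (card {l \<in> {1..N n}. L n k l = t}) \<le> B"
    and x_indep: "prob_space.indep_vars M (\<lambda>_. borel) x UNIV"
    and x_mean: "\<And>i. prob_space.expectation M (x i) = 0"
    and \<alpha>_pos: "\<alpha> > 0"
    and x_integrable: "\<And>i k. k \<ge> 1 \<Longrightarrow> integrable M (\<lambda>\<omega>. \<bar>x i \<omega>\<bar> ^ k)"
    and x_moment: "\<And>i k. k \<ge> 1 \<Longrightarrow>
                     prob_space.expectation M (\<lambda>\<omega>. \<bar>x i \<omega>\<bar> ^ k) \<le> (\<alpha> * real k) ^ k"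
    and c_pos: "c > 0"
    and var_lower: "\<And>n. n \<ge> 1 \<Longrightarrow>
                      c ^ p n * real (N n)
                        \<le> prob_space.variance M (trace_power (N n) (L n) (\<Delta> n) (p n) x)"
  shows "weak_conv_m
           (\<lambda>n. distr M borel
              (\<lambda>\<omega>. (trace_power (N n) (L n) (\<Delta> n) (p n) x \<omega>
                       - prob_space.expectation M (trace_power (N n) (L n) (\<Delta> n) (p n) x))
                    / sqrt (prob_space.variance M (trace_power (N n) (L n) (\<Delta> n) (p n) x))))
           std_normal_distribution"
proof -
  interpret prob_space M by fact
  define T where "T n = trace_power (N n) (L n) (\<Delta> n) (p n) x" for n
  define \<eta> where "\<eta> n = (\<lambda>\<omega>. (T n \<omega> - expectation (T n)) / sqrt (variance (T n)))" for n
  have x: "all_moments (x t)" for t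
  proof -
    have "integrable M (\<lambda>\<omega>. \<bar>x t \<omega>\<bar> ^ k)" for k using x_integrable[of k t] by (cases k) auto
    then show ?thesis using x_indep by (simp add: all_moments_def indep_vars_def)
  qed
  have \<eta>_moments: "all_moments (\<eta> n)" for n
    unfolding \<eta>_def T_def divide_inverse
    by (intro all_moments_mult all_moments_diff all_moments_const all_moments_trace_power x)
  then have \<eta>_rv [measurable]: "\<eta> n \<in> borel_measurable M" for n by (rule all_moments_measurable)
  \<comment> \<open>Strict monotonicity starts at index 1, where \<open>N\<close> may still vanish.\<close>
  have N_large: "n \<le> Suc (N n)" if "n \<ge> 1" for n
    using that
  proof (induction n rule: dec_induct)
    case (step n)
    have "N n < N (Suc n)" using step.hyps by (intro strict_mono_onD[OF N_mono]) auto
    then show ?case using step.IH by simp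
  qed simp
  have N: "filterlim N at_top sequentially"
    unfolding filterlim_at_top
  proof
    fix Z
    show "eventually (\<lambda>n. Z \<le> N n) sequentially"
      using eventually_ge_at_top[of "Suc Z"]
    proof eventually_elim
      case (elim n)
      then show ?case using N_large[of n] by simp
    qed
  qed
  have ev: "eventually (\<lambda>n. n \<ge> 1 \<and> N n \<ge> 1) sequentially"
    using eventually_ge_at_top[of 1] N[unfolded filterlim_at_top, rule_format, of 1] by eventually_elim auto
  obtain n1 where n1: "n1 \<ge> 1" "N n1 \<ge> 1"
    using ev by (auto simp: eventually_sequentially)
  have B: "B \<ge> 0"
    using L_bound[of n1 1 "L n1 1 1"] n1 by (auto intro: order_trans[OF of_nat_0_le_iff])
  have mean: "expectation (\<eta> n) = 0"
    and rec: "\<bar>expectation (\<lambda>\<omega>. \<eta> n \<omega> ^ Suc (Suc k)) - real (Suc k) * expectation (\<lambda>\<omega>. \<eta> n \<omega> ^ k)\<bar>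
      \<le> recursion_error B \<alpha> c k (p n) / sqrt (real (N n))" if n: "n \<ge> 1" "N n \<ge> 1" for n k
    unfolding \<eta>_def T_def
    using normalized_trace_moments[OF n(2) p_pos[OF n(1)] p_even[OF n(1)] L_bound[OF n(1)] x_indep x_mean \<alpha>_pos
      x_integrable x_moment c_pos var_lower[OF n(1)]] by blast+
  have moments: "(\<lambda>n. expectation (\<lambda>\<omega>. \<eta> n \<omega> ^ k)) \<longlonglongrightarrow> (LINT x|std_normal_distribution. x ^ k)" for k
  proof (induction k rule: induct_nat_012)
    case 0
    interpret normal: prob_space std_normal_distribution
      using real_dist_normal_dist by (simp add: real_distribution_def)
    show ?case using normal.prob_space by (simp add: prob_space)
  next
    case 1
    have "eventually (\<lambda>n. 0 = expectation (\<lambda>\<omega>. \<eta> n \<omega> ^ Suc 0)) sequentially"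
      using ev by eventually_elim (use mean in simp)
    then have "(\<lambda>n. expectation (\<lambda>\<omega>. \<eta> n \<omega> ^ Suc 0)) \<longlonglongrightarrow> 0"
      by (rule Lim_transform_eventually[OF tendsto_const])
    moreover have "(LINT x|std_normal_distribution. x ^ Suc 0) = 0"
      by (rule integral_std_normal_distribution_moment_odd) simp
    ultimately show ?case by simp
  next
    case (ge2 k)
    define d where "d n = expectation (\<lambda>\<omega>. \<eta> n \<omega> ^ Suc (Suc k)) - real (Suc k) * expectation (\<lambda>\<omega>. \<eta> n \<omega> ^ k)" for n
    have "d \<longlonglongrightarrow> 0"
    proof (rule Lim_null_comparison)
      show "eventually (\<lambda>n. norm (d n) \<le> recursion_error B \<alpha> c k (p n) / sqrt (real (N n))) sequentially"
        using ev by eventually_elim (use rec in \<open>simp add: d_def\<close>)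
      show "(\<lambda>n. recursion_error B \<alpha> c k (p n) / sqrt (real (N n))) \<longlonglongrightarrow> 0"
        using subpolynomial_imp_tendsto_0[OF N] subpolynomial_recursion_error[OF N p_small B \<alpha>_pos] by blast
    qed
    then have "(\<lambda>n. d n + real (Suc k) * expectation (\<lambda>\<omega>. \<eta> n \<omega> ^ k)) \<longlonglongrightarrow>
        0 + real (Suc k) * (LINT x|std_normal_distribution. x ^ k)"
      by (intro tendsto_intros ge2.IH)
    then show ?case by (simp only: d_def std_normal_moment_recursion) simp
  qed
  have "weak_conv_m (\<lambda>n. distr M borel (\<eta> n)) std_normal_distribution"
  proof (rule weak_conv_std_normal_if_moments_tendsto)
    show "real_distribution (distr M borel (\<eta> n))" for n by (rule real_distribution_distr) simp
    show "integrable (distr M borel (\<eta> n)) (\<lambda>x. x ^ k)" for n k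
      by (subst integrable_distr_eq) (auto intro: all_moments_integrable all_moments_power \<eta>_moments)
    show "(\<lambda>n. LINT x|distr M borel (\<eta> n). x ^ k) \<longlonglongrightarrow> (LINT x|std_normal_distribution. x ^ k)" for k
      using moments[of k] by (subst integral_distr) auto
  qed
  then show ?thesis unfolding \<eta>_def T_def .
qed

end
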